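(* For every $n\ge 2$, there are rotationally symmetric Riemannian metrics on $\mathbb{S}^n$ which support a density $f$ such that $\sec_f>0$, but which do not have $\sec\ge 0$.
   Context: A density is a smooth function $f$ on the manifold. A rotationally symmetric metric on $\mathbb{S}^n$ is a smooth metric of the form $g=dr^2+\phi^2(r)g_{\mathbb{S}^{n-1}}$, $r\in[0,2L]$, where $g_{\mathbb{S}^{n-1}}$ is the round metric of curvature $1$, $\phi>0$ on $(0,2L)$, $\phi(0)=\phi(2L)=0$, $\phi'(0)=1$, $\phi'(2L)=-1$, and all even derivatives of $\phi$ vanish at $0$ and $2L$. For an orthonormal pair $(U,V)$ of tangent vectors, $\sec_f^V(U)=\sec(U,V)+\mathrm{Hess}\,f(V,V)$, and $\sec_f>0$ means $\sec_f^V(U)>0$ for every orthonormal pair $(U,V)$ at every point. $\sec\ge0$ means nonnegative sectional curvature. *)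

theory Defs
  imports "HOL-Analysis.Analysis"
begin

text \<open>
  The n-sphere is the unit sphere of \<^typ>\<open>(real ^ 'n) \<times> real\<close> with n = CARD('n); a point is a pair
  (y, z), the poles being (0, 1) and (0, -1).  Its smooth structure is given by the two
  stereographic charts, and the geometric quantities are defined in these charts.
\<close>

type_synonym 'n ambient = "(real ^ 'n) \<times> real"

abbreviation unit_sphere :: "('n::finite) ambient set" where
  "unit_sphere \<equiv> sphere 0 1"

definition tangent_space :: "('n::finite) ambient \<Rightarrow> 'n ambient set" where
  "tangent_space p = {v. p \<bullet> v = 0}"

subsection \<open>Smooth functions\<close>

primrec C_times :: "nat \<Rightarrow> ('a::euclidean_space \<Rightarrow> real) \<Rightarrow> bool" where
  "C_times 0 h \<longleftrightarrow> continuous_on UNIV h"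
| "C_times (Suc k) h \<longleftrightarrow>
     h differentiable_on UNIV \<and> (\<forall>v. C_times k (\<lambda>x. frechet_derivative h (at x) v))"

definition smooth :: "('a::euclidean_space \<Rightarrow> real) \<Rightarrow> bool" where
  "smooth h \<longleftrightarrow> (\<forall>k. C_times k h)"

subsection \<open>Stereographic charts\<close>

text \<open>
  For s = 1 this is the projection from the pole (0, -1), for s = -1 that from (0, 1).  The formula
  also makes sense near the sphere, so its Frechet derivative at a point of the sphere can be
  applied to tangent vectors.
\<close>

definition stereo :: "real \<Rightarrow> ('n::finite) ambient \<Rightarrow> real ^ 'n" where
  "stereo s p = fst p /\<^sub>R (1 + s * snd p)"

definition stereo_inv :: "real \<Rightarrow> real ^ 'n \<Rightarrow> ('n::finite) ambient" where
  "stereo_inv s x =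
     ((2 / (1 + (norm x)\<^sup>2)) *\<^sub>R x, s * (1 - (norm x)\<^sup>2) / (1 + (norm x)\<^sup>2))"

definition chart_at :: "('n::finite) ambient \<Rightarrow> real" where
  "chart_at p = (if snd p \<ge> 0 then 1 else -1)"

definition smooth_on_sphere :: "(('n::finite) ambient \<Rightarrow> real) \<Rightarrow> bool" where
  "smooth_on_sphere f \<longleftrightarrow> (\<forall>s\<in>{1, -1}. smooth (\<lambda>x. f (stereo_inv s x)))"

subsection \<open>Riemannian metrics on the sphere\<close>

text \<open>Only the values g p u v with p on the sphere and u, v tangent at p are meaningful.\<close>

type_synonym 'n metric = "'n ambient \<Rightarrow> 'n ambient \<Rightarrow> 'n ambient \<Rightarrow> real"

definition metric_matrix :: "('n::finite) metric \<Rightarrow> real \<Rightarrow> real ^ 'n \<Rightarrow> real ^ 'n ^ 'n" where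
  "metric_matrix g s x =
     (\<chi> i j. g (stereo_inv s x)
               (frechet_derivative (stereo_inv s) (at x) (axis i 1))
               (frechet_derivative (stereo_inv s) (at x) (axis j 1)))"

definition riemannian_metric :: "('n::finite) metric \<Rightarrow> bool" where
  "riemannian_metric g \<longleftrightarrow>
     (\<forall>p\<in>unit_sphere. \<forall>u\<in>tangent_space p. \<forall>v\<in>tangent_space p. \<forall>w\<in>tangent_space p.
        g p u v = g p v u \<and>
        (\<forall>a b. g p (a *\<^sub>R u + b *\<^sub>R v) w = a * g p u w + b * g p v w) \<and>
        (u \<noteq> 0 \<longrightarrow> g p u u > 0)) \<and>
     (\<forall>s\<in>{1, -1}. \<forall>i j. smooth (\<lambda>x. metric_matrix g s x $ i $ j))"

definition orthonormal_pair ::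
  "('n::finite) metric \<Rightarrow> 'n ambient \<Rightarrow> 'n ambient \<Rightarrow> 'n ambient \<Rightarrow> bool" where
  "orthonormal_pair g p U V \<longleftrightarrow>
     U \<in> tangent_space p \<and> V \<in> tangent_space p \<and> g p U U = 1 \<and> g p V V = 1 \<and> g p U V = 0"

subsection \<open>Curvature and Hessian in coordinates\<close>

definition partial :: "'n \<Rightarrow> (real ^ 'n \<Rightarrow> real) \<Rightarrow> real ^ 'n \<Rightarrow> real" where
  "partial i h x = frechet_derivative h (at x) (axis i 1)"

text \<open>\<open>christoffel G k i j\<close> is the symbol with upper index k and lower indices i, j.\<close>

definition christoffel ::
  "(real ^ 'n \<Rightarrow> real ^ 'n ^ 'n) \<Rightarrow> 'n::finite \<Rightarrow> 'n \<Rightarrow> 'n \<Rightarrow> real ^ 'n \<Rightarrow> real" where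
  "christoffel G k i j x =
     (\<Sum>l\<in>UNIV. matrix_inv (G x) $ k $ l *
        (partial i (\<lambda>y. G y $ j $ l) x + partial j (\<lambda>y. G y $ i $ l) x
         - partial l (\<lambda>y. G y $ i $ j) x)) / 2"

text \<open>
  \<open>riemann G l i j k\<close> is the l-th component of \<open>R(\<partial>\<^sub>i, \<partial>\<^sub>j) \<partial>\<^sub>k\<close>, with the sign
  convention \<open>R(X, Y) Z = \<nabla>\<^sub>X \<nabla>\<^sub>Y Z - \<nabla>\<^sub>Y \<nabla>\<^sub>X Z - \<nabla>\<^bsub>[X, Y]\<^esub> Z\<close>.
\<close>

definition riemann ::
  "(real ^ 'n \<Rightarrow> real ^ 'n ^ 'n) \<Rightarrow> 'n::finite \<Rightarrow> 'n \<Rightarrow> 'n \<Rightarrow> 'n \<Rightarrow> real ^ 'n \<Rightarrow> real" where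
  "riemann G l i j k x =
     partial i (christoffel G l j k) x - partial j (christoffel G l i k) x
     + (\<Sum>m\<in>UNIV. christoffel G l i m x * christoffel G m j k x
                   - christoffel G l j m x * christoffel G m i k x)"

definition inner_coord :: "real ^ 'n ^ 'n \<Rightarrow> real ^ 'n \<Rightarrow> real ^ 'n::finite \<Rightarrow> real" where
  "inner_coord A u v = u \<bullet> (A *v v)"

definition curvature_vec ::
  "(real ^ 'n \<Rightarrow> real ^ 'n ^ 'n) \<Rightarrow> real ^ 'n \<Rightarrow> real ^ 'n \<Rightarrow> real ^ 'n \<Rightarrow> real ^ 'n
    \<Rightarrow> real ^ 'n::finite" where
  "curvature_vec G x u v w =
     (\<chi> l. \<Sum>i\<in>UNIV. \<Sum>j\<in>UNIV. \<Sum>k\<in>UNIV. riemann G l i j k x * u $ i * v $ j * w $ k)"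

definition sec_coord ::
  "(real ^ 'n \<Rightarrow> real ^ 'n ^ 'n) \<Rightarrow> real ^ 'n \<Rightarrow> real ^ 'n \<Rightarrow> real ^ 'n::finite \<Rightarrow> real" where
  "sec_coord G x u v =
     inner_coord (G x) (curvature_vec G x u v v) u
     / (inner_coord (G x) u u * inner_coord (G x) v v - (inner_coord (G x) u v)\<^sup>2)"

definition hess_coord ::
  "(real ^ 'n \<Rightarrow> real ^ 'n ^ 'n) \<Rightarrow> (real ^ 'n \<Rightarrow> real) \<Rightarrow> real ^ 'n \<Rightarrow> real ^ 'n
    \<Rightarrow> real ^ 'n::finite \<Rightarrow> real" where
  "hess_coord G h x u v =
     (\<Sum>i\<in>UNIV. \<Sum>j\<in>UNIV.
        (partial i (partial j h) x - (\<Sum>k\<in>UNIV. christoffel G k i j x * partial k h x))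
        * u $ i * v $ j)"

subsection \<open>Curvature and Hessian on the sphere\<close>

definition coord_vec :: "('n::finite) ambient \<Rightarrow> 'n ambient \<Rightarrow> real ^ 'n" where
  "coord_vec p U = frechet_derivative (stereo (chart_at p)) (at p) U"

definition sec ::
  "('n::finite) metric \<Rightarrow> 'n ambient \<Rightarrow> 'n ambient \<Rightarrow> 'n ambient \<Rightarrow> real" where
  "sec g p U V =
     sec_coord (metric_matrix g (chart_at p)) (stereo (chart_at p) p)
       (coord_vec p U) (coord_vec p V)"

definition Hess ::
  "('n::finite) metric \<Rightarrow> ('n ambient \<Rightarrow> real) \<Rightarrow> 'n ambient \<Rightarrow> 'n ambient \<Rightarrow> 'n ambient
    \<Rightarrow> real" where
  "Hess g f p U V =
     hess_coord (metric_matrix g (chart_at p)) (\<lambda>x. f (stereo_inv (chart_at p) x))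
       (stereo (chart_at p) p) (coord_vec p U) (coord_vec p V)"

definition sec_nonneg :: "('n::finite) metric \<Rightarrow> bool" where
  "sec_nonneg g \<longleftrightarrow>
     (\<forall>p\<in>unit_sphere. \<forall>U V. orthonormal_pair g p U V \<longrightarrow> sec g p U V \<ge> 0)"

text \<open>\<open>weighted_sec g f p V U\<close> is the curvature written with superscript V and argument U.\<close>

definition weighted_sec ::
  "('n::finite) metric \<Rightarrow> ('n ambient \<Rightarrow> real) \<Rightarrow> 'n ambient \<Rightarrow> 'n ambient \<Rightarrow> 'n ambient
    \<Rightarrow> real" where
  "weighted_sec g f p V U = sec g p U V + Hess g f p V V"

definition weighted_sec_pos :: "('n::finite) metric \<Rightarrow> ('n ambient \<Rightarrow> real) \<Rightarrow> bool" where
  "weighted_sec_pos g f \<longleftrightarrow>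
     (\<forall>p\<in>unit_sphere. \<forall>U V. orthonormal_pair g p U V \<longrightarrow> weighted_sec g f p V U > 0)"

subsection \<open>Rotationally symmetric metrics\<close>

text \<open>
  The cylinder [0, 2L] x S^(n-1), with each end collapsed to a point, is identified with the
  sphere by \<open>polar_map L\<close>.  The formula is given for all y in \<^typ>\<open>real ^ 'n\<close>, so that it can be
  differentiated; it is used at unit vectors y and on tangent vectors (a, \<xi>) with \<xi> orthogonal to y.
\<close>

definition polar_map :: "real \<Rightarrow> real \<times> (real ^ 'n) \<Rightarrow> ('n::finite) ambient" where
  "polar_map L = (\<lambda>(r, y). (sin (pi * r / (2 * L)) *\<^sub>R y, cos (pi * r / (2 * L))))"

text \<open>
  Smoothness of the profile on [0, 2L] up to the end points is expressed by taking \<phi> to be (the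
  restriction of) a smooth function on the real line.
\<close>

definition warping_profile :: "real \<Rightarrow> (real \<Rightarrow> real) \<Rightarrow> bool" where
  "warping_profile L \<phi> \<longleftrightarrow>
     smooth \<phi> \<and> (\<forall>r\<in>{0<..<2 * L}. \<phi> r > 0) \<and>
     \<phi> 0 = 0 \<and> \<phi> (2 * L) = 0 \<and> deriv \<phi> 0 = 1 \<and> deriv \<phi> (2 * L) = -1 \<and>
     (\<forall>k. even k \<longrightarrow> (deriv ^^ k) \<phi> 0 = 0 \<and> (deriv ^^ k) \<phi> (2 * L) = 0)"

text \<open>The round metric of S^(n-1) is the restriction of the inner product of \<^typ>\<open>real ^ 'n\<close>.\<close>

definition rotationally_symmetric :: "('n::finite) metric \<Rightarrow> bool" where
  "rotationally_symmetric g \<longleftrightarrow>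
     riemannian_metric g \<and>
     (\<exists>L>0. \<exists>\<phi>. warping_profile L \<phi> \<and>
        (\<forall>r\<in>{0<..<2 * L}. \<forall>\<theta>\<in>sphere 0 1. \<forall>a b \<xi> \<eta>. \<theta> \<bullet> \<xi> = 0 \<longrightarrow> \<theta> \<bullet> \<eta> = 0 \<longrightarrow>
           g (polar_map L (r, \<theta>))
             (frechet_derivative (polar_map L) (at (r, \<theta>)) (a, \<xi>))
             (frechet_derivative (polar_map L) (at (r, \<theta>)) (b, \<eta>))
           = a * b + (\<phi> r)\<^sup>2 * (\<xi> \<bullet> \<eta>)))"

end

theory Submission
  imports Defs
begin

text \<open>
  Take L = \<open>\<pi>/2\<close> and the profile \<open>\<phi>(r) = sin r + sin\<^sup>3 r / 4\<close>, so that r is the polar angle and the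
  metric is polynomial in the ambient coordinates.  With \<open>t = sin\<^sup>2 r\<close>, the radial and the tangential
  curvature are \<open>(9t - 2)/(4 + t)\<close> and \<open>(9t\<^sup>2 + 15t - 8)/(4 + t)\<^sup>2\<close>, both negative at the poles.  The
  density \<open>f = t/2\<close> has the Hessian eigenvalues \<open>1 - 2t\<close> (radial) and \<open>(1 - t)(4 + 3t)/(4 + t)\<close>
  (tangential), which compensate the negative curvature near the poles and are dominated by the
  positive curvature near the equator.  For an orthonormal pair (U, V) with radial components u and v,
  the weighted curvature is the convex combination, with weights \<open>v\<^sup>2\<close>, \<open>u\<^sup>2\<close> and \<open>1 - u\<^sup>2 - v\<^sup>2\<close>, of
  the three sums radial + radial, radial + tangential and tangential + tangential, all positive.

  In both stereographic charts the metric has the form \<open>a(q) \<delta>\<^sub>i\<^sub>j + b(q) x\<^sub>i x\<^sub>j\<close> with \<open>q = |x|\<^sup>2\<close>.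
  The Christoffel symbols and the curvature tensor of such a metric are again combinations of
  Kronecker deltas and coordinates with coefficients depending on q only.
\<close>

section \<open>Closure properties of smooth functions\<close>

text \<open>The derivative may be supplied in closed form, so that the inductions below never
  compute \<open>frechet_derivative\<close> of a compound function.\<close>

lemma C_times_SucI:
  assumes "\<And>x. (h has_derivative h' x) (at x)" "\<And>v. C_times k (\<lambda>x. h' x v)"
  shows "C_times (Suc k) h"
proof -
  have "frechet_derivative h (at x) = h' x" for x
    using frechet_derivative_at[OF assms(1)] by simp
  moreover have "h differentiable_on UNIV"
    using assms(1) by (auto simp: differentiable_on_def differentiable_def)
  ultimately show ?thesis using assms(2) by simp
qed

lemma C_times_Suc_has_derivative:
  assumes "C_times (Suc k) h"
  shows "(h has_derivative frechet_derivative h (at x)) (at x)"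
  using assms by (auto simp: differentiable_on_def frechet_derivative_works)

lemma C_times_Suc_imp: "C_times (Suc k) h \<Longrightarrow> C_times k h"
proof (induction k arbitrary: h)
  case 0
  then show ?case by (simp add: differentiable_imp_continuous_on)
next
  case (Suc k)
  show ?case
    using Suc.prems by (intro C_times_SucI[OF C_times_Suc_has_derivative[OF Suc.prems]])
      (auto intro: Suc.IH)
qed

lemma C_times_const: "C_times k (\<lambda>x. c)"
  by (induction k arbitrary: c) (auto intro: C_times_SucI[where h' = "\<lambda>_ _. 0"] simp del: C_times.simps(2))

lemma C_times_linear:
  assumes "bounded_linear h"
  shows "C_times k h"
proof (cases k)
  case 0
  then show ?thesis using assms by (simp add: linear_continuous_on)
next
  case (Suc m)
  show ?thesis unfolding Suc
    by (rule C_times_SucI[OF bounded_linear_imp_has_derivative[OF assms] C_times_const])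
qed

lemma C_times_add: "C_times k g \<Longrightarrow> C_times k h \<Longrightarrow> C_times k (\<lambda>x. g x + h x)"
proof (induction k arbitrary: g h)
  case 0
  then show ?case by (auto intro: continuous_intros)
next
  case (Suc k)
  show ?case
    by (rule C_times_SucI[OF has_derivative_add[OF Suc.prems[THEN C_times_Suc_has_derivative]]])
      (use Suc in auto)
qed

text \<open>The product rule leaves undifferentiated factors beside the derivatives. They are of
  class k+1, so \<open>C_times_Suc_imp\<close> lowers them to class k before the induction
  hypothesis applies.\<close>

lemma C_times_mult: "C_times k g \<Longrightarrow> C_times k h \<Longrightarrow> C_times k (\<lambda>x. g x * h x)"
proof (induction k arbitrary: g h)
  case 0
  then show ?case by (auto intro: continuous_intros)
next
  case (Suc k)
  show ?case
    by (rule C_times_SucI[OF has_derivative_mult[OF Suc.prems[THEN C_times_Suc_has_derivative]]])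
      (use Suc.prems Suc.prems[THEN C_times_Suc_imp] in \<open>auto intro!: C_times_add Suc.IH\<close>)
qed

lemma C_times_inverse:
  assumes "\<And>x. h x \<noteq> 0"
  shows "C_times k h \<Longrightarrow> C_times k (\<lambda>x. inverse (h x))"
proof (induction k)
  case 0
  then show ?case using assms by (auto intro!: continuous_intros)
next
  case (Suc k)
  have inv: "C_times k (\<lambda>x. inverse (h x))" using Suc.IH C_times_Suc_imp[OF Suc.prems] .
  show ?case
  proof (rule C_times_SucI[OF Deriv.has_derivative_inverse[OF assms C_times_Suc_has_derivative[OF Suc.prems]]])
    fix v
    have "C_times k (\<lambda>x. (- 1) * (inverse (h x) * frechet_derivative h (at x) v * inverse (h x)))"
      using Suc.prems by (intro C_times_mult C_times_const inv) auto
    then show "C_times k (\<lambda>x. - (inverse (h x) * frechet_derivative h (at x) v * inverse (h x)))"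
      by simp
  qed
qed

text \<open>Differentiation turns each of the two functions into a multiple of the other, hence a
  simultaneous induction.\<close>

lemma C_times_sin_cos:
  fixes m :: real
  shows "C_times k (\<lambda>r. sin (m * r)) \<and> C_times k (\<lambda>r. cos (m * r))"
proof (induction k)
  case 0
  show ?case by (auto intro!: continuous_intros)
next
  case (Suc k)
  have ds: "((\<lambda>r. sin (m * r)) has_derivative (\<lambda>v. (m * v) * cos (m * x))) (at x)" for x
    by (auto intro!: derivative_eq_intros)
  have dc: "((\<lambda>r. cos (m * r)) has_derivative (\<lambda>v. (- (m * v)) * sin (m * x))) (at x)" for x
    by (auto intro!: derivative_eq_intros)
  show ?case
    using Suc by (intro conjI C_times_SucI[OF ds] C_times_SucI[OF dc] C_times_mult C_times_const) auto
qed

named_theorems smooth_intros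

lemma smooth_const [smooth_intros]: "smooth (\<lambda>x. c)"
  by (simp add: smooth_def C_times_const)

lemma smooth_linear: "bounded_linear h \<Longrightarrow> smooth h"
  by (simp add: smooth_def C_times_linear)

lemma smooth_vec_nth [smooth_intros]: "smooth (\<lambda>x. x $ i)"
  by (intro smooth_linear bounded_linear_vec_nth)

lemma smooth_add [smooth_intros]: "smooth g \<Longrightarrow> smooth h \<Longrightarrow> smooth (\<lambda>x. g x + h x)"
  by (simp add: smooth_def C_times_add)

lemma smooth_mult [smooth_intros]: "smooth g \<Longrightarrow> smooth h \<Longrightarrow> smooth (\<lambda>x. g x * h x)"
  by (simp add: smooth_def C_times_mult)

lemma smooth_power [smooth_intros]: "smooth g \<Longrightarrow> smooth (\<lambda>x. g x ^ n)"
  by (induction n) (auto intro: smooth_intros)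

lemma smooth_divide [smooth_intros]:
  "smooth g \<Longrightarrow> smooth h \<Longrightarrow> (\<And>x. h x \<noteq> 0) \<Longrightarrow> smooth (\<lambda>x. g x / h x)"
  by (simp add: smooth_def divide_inverse C_times_mult C_times_inverse)

lemma smooth_sum [smooth_intros]:
  "(\<And>i. i \<in> I \<Longrightarrow> smooth (g i)) \<Longrightarrow> smooth (\<lambda>x. \<Sum>i\<in>I. g i x)"
  by (induction I rule: infinite_finite_induct) (auto intro: smooth_intros)

lemma smooth_inner_self [smooth_intros]: "smooth (\<lambda>x :: real ^ 'n. x \<bullet> x)"
  by (simp add: inner_vec_def) (intro smooth_intros)

lemma smooth_sin [smooth_intros]: "smooth (\<lambda>r. sin (m * r))" for m :: real
  by (simp add: smooth_def C_times_sin_cos)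

section \<open>Tensors built from a radial function\<close>

text \<open>A named constant rather than a conditional: in index computations it stays an atom for
  \<open>algebra_simps\<close> and causes no case splits.\<close>

definition kdelta :: "'a \<Rightarrow> 'a \<Rightarrow> real" where
  "kdelta i j = (if i = j then 1 else 0)"

lemma kdelta_commute: "kdelta i j = kdelta j i"
  by (simp add: kdelta_def)

lemma sum_kdelta:
  fixes i :: "'n::finite"
  shows "(\<Sum>j\<in>UNIV. kdelta i j * c j) = c i" "(\<Sum>j\<in>UNIV. kdelta j i * c j) = c i"
    "(\<Sum>j\<in>UNIV. c j * kdelta i j) = c i" "(\<Sum>j\<in>UNIV. c j * kdelta j i) = c i"
  by (simp_all add: kdelta_def if_distrib[of "\<lambda>x. x * _"] if_distrib[of "\<lambda>x. _ * x"] cong: if_cong)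

lemma has_derivative_radial:
  fixes x :: "'a::real_inner"
  assumes "(a has_real_derivative a') (at (x \<bullet> x))"
  shows "((\<lambda>y. a (y \<bullet> y)) has_derivative (\<lambda>v. a' * (2 * (x \<bullet> v)))) (at x)"
proof -
  have "((\<lambda>y. y \<bullet> y) has_derivative (\<lambda>v. 2 * (x \<bullet> v))) (at x)"
    by (auto intro!: derivative_eq_intros simp: inner_commute)
  from has_derivative_compose[OF this assms[unfolded has_field_derivative_def]]
  show ?thesis by simp
qed

lemma has_derivative_vec_nth: "((\<lambda>y. y $ i) has_derivative (\<lambda>v. v $ i)) (at x)"
  by (intro bounded_linear_imp_has_derivative bounded_linear_vec_nth)

lemma partialI: "(h has_derivative h') (at x) \<Longrightarrow> partial i h x = h' (axis i 1)"
  using frechet_derivative_at[of h h' x] by (simp add: partial_def)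

lemma axis_nth_kdelta: "axis i 1 $ j = kdelta i j"
  by (simp add: kdelta_def axis_def)

definition radial_form :: "(real \<Rightarrow> real) \<Rightarrow> (real \<Rightarrow> real) \<Rightarrow> real ^ 'n \<Rightarrow> real ^ 'n ^ 'n" where
  "radial_form a b x = (\<chi> i j. a (x \<bullet> x) * kdelta i j + b (x \<bullet> x) * (x $ i * x $ j))"

text \<open>The shape that symmetry in i, j and equivariance under rotations and reflections leave
  for a tensor built from x.\<close>

definition radial_christoffel ::
  "(real \<Rightarrow> real) \<Rightarrow> (real \<Rightarrow> real) \<Rightarrow> (real \<Rightarrow> real) \<Rightarrow> 'n \<Rightarrow> 'n \<Rightarrow> 'n \<Rightarrow> real ^ 'n \<Rightarrow> real" where
  "radial_christoffel A B C k i j x =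
     A (x \<bullet> x) * (x $ i * kdelta j k + x $ j * kdelta i k) + B (x \<bullet> x) * (x $ k * kdelta i j)
     + C (x \<bullet> x) * (x $ i * x $ j * x $ k)"

lemma radial_form_mult_vec:
  "radial_form a b x *v v = a (x \<bullet> x) *\<^sub>R v + (b (x \<bullet> x) * (x \<bullet> v)) *\<^sub>R (x :: real ^ 'n::finite)"
proof -
  have "(\<Sum>j\<in>UNIV. (a (x \<bullet> x) * kdelta i j + b (x \<bullet> x) * (x $ i * x $ j)) * v $ j)
    = (\<Sum>j\<in>UNIV. kdelta i j * (a (x \<bullet> x) * v $ j)) + b (x \<bullet> x) * x $ i * (\<Sum>j\<in>UNIV. x $ j * v $ j)" for i
    by (simp add: sum_distrib_left sum.distrib[symmetric] algebra_simps)
  then show ?thesis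
    by (simp add: vec_eq_iff matrix_vector_mult_def radial_form_def sum_kdelta inner_vec_def)
qed

lemma inner_coord_radial_form:
  "inner_coord (radial_form a b x) u v = a (x \<bullet> x) * (u \<bullet> v) + b (x \<bullet> x) * (x \<bullet> u) * (x \<bullet> v)"
  by (simp add: inner_coord_def radial_form_mult_vec inner_simps inner_commute)

text \<open>\<open>matrix_inv\<close> chooses a two-sided inverse. For a square matrix a right
  inverse is two-sided, and two-sided inverses are unique.\<close>

lemma matrix_inv_eqI:
  fixes M :: "real ^ 'n::finite ^ 'n"
  assumes "\<And>v. M *v (N *v v) = v"
  shows "matrix_inv M = N"
proof -
  have "M ** N = mat 1"
    using assms by (simp add: matrix_eq matrix_vector_mul_assoc)
  moreover from this have "N ** M = mat 1" using matrix_left_right_inverse by blast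
  ultimately have inv: "M ** matrix_inv M = mat 1"
    unfolding matrix_inv_def
    using someI[of "\<lambda>N. M ** N = mat 1 \<and> N ** M = mat 1" N] by simp
  have "matrix_inv M = (N ** M) ** matrix_inv M" using \<open>N ** M = mat 1\<close> by simp
  also have "\<dots> = N" by (simp add: inv matrix_mul_assoc[symmetric])
  finally show ?thesis .
qed

text \<open>Sherman-Morrison formula for a rank-one change of a multiple of the identity. The
  eigenvalues are a across x and a + bq along x; the hypotheses keep both away from 0.\<close>

lemma matrix_inv_radial_form:
  fixes x :: "real ^ 'n::finite"
  assumes "a (x \<bullet> x) \<noteq> 0" "a (x \<bullet> x) + b (x \<bullet> x) * (x \<bullet> x) \<noteq> 0"
  shows "matrix_inv (radial_form a b x)
    = radial_form (\<lambda>q. 1 / a q) (\<lambda>q. - b q / (a q * (a q + b q * q))) x"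
proof (rule matrix_inv_eqI)
  fix v
  let ?a = "a (x \<bullet> x)" and ?b = "b (x \<bullet> x)" and ?q = "x \<bullet> x"
  define d where "d = - ?b / (?a * (?a + ?b * ?q))"
  have d: "?b / ?a + d * (?a + ?b * ?q) = 0"
    using assms by (simp add: d_def)
  have "radial_form a b x *v (radial_form (\<lambda>q. 1 / a q) (\<lambda>q. - b q / (a q * (a q + b q * q))) x *v v)
    = v + ((?b / ?a + d * (?a + ?b * ?q)) * (x \<bullet> v)) *\<^sub>R x"
    unfolding radial_form_mult_vec d_def[symmetric]
    using assms(1) by (simp add: inner_simps scaleR_add_right scaleR_add_left algebra_simps)
  then show "radial_form a b x *v (radial_form (\<lambda>q. 1 / a q) (\<lambda>q. - b q / (a q * (a q + b q * q))) x *v v) = v"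
    by (simp add: d)
qed

lemma partial_radial_form:
  fixes x :: "real ^ 'n::finite"
  assumes "(a has_real_derivative a') (at (x \<bullet> x))" "(b has_real_derivative b') (at (x \<bullet> x))"
  shows "partial i (\<lambda>y. radial_form a b y $ j $ l) x
    = 2 * a' * x $ i * kdelta j l + 2 * b' * x $ i * x $ j * x $ l
      + b (x \<bullet> x) * (kdelta i j * x $ l + kdelta i l * x $ j)"
  unfolding radial_form_def
  by (simp, subst partialI, (rule derivative_intros has_derivative_vec_nth
        has_derivative_radial[OF assms(1)] has_derivative_radial[OF assms(2)])+)
    (simp add: inner_axis axis_nth_kdelta algebra_simps)

lemma christoffel_radial_form:
  fixes x :: "real ^ 'n::finite"
  assumes G: "G = radial_form a b"
    and da: "(a has_real_derivative a') (at (x \<bullet> x))"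
    and db: "(b has_real_derivative b') (at (x \<bullet> x))"
    and a: "a (x \<bullet> x) \<noteq> 0" and c: "c = a (x \<bullet> x) + b (x \<bullet> x) * (x \<bullet> x)" "c \<noteq> 0"
    and A: "A (x \<bullet> x) = a' / a (x \<bullet> x)"
    and B: "B (x \<bullet> x) = (b (x \<bullet> x) - a') / c"
    and C: "C (x \<bullet> x) = (b' - 2 * a' * b (x \<bullet> x) / a (x \<bullet> x)) / c"
  shows "christoffel G k i j x = radial_christoffel A B C k i j x"
proof -
  let ?a = "a (x \<bullet> x)" and ?b = "b (x \<bullet> x)" and ?q = "x \<bullet> x"
  \<comment> \<open>Twice the Christoffel symbols of the first kind for fixed i, j, as a vector in
    the remaining index. The rank-one part of the inverse metric needs its product with x.\<close>
  define V where "V = (\<chi> l. 2 * (a' * (x $ i * kdelta j l + x $ j * kdelta i l)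
    + ((?b - a') * kdelta i j + b' * x $ i * x $ j) * x $ l))"
  have V: "V $ l = partial i (\<lambda>y. G y $ j $ l) x + partial j (\<lambda>y. G y $ i $ l) x
         - partial l (\<lambda>y. G y $ i $ j) x" for l
    unfolding G partial_radial_form[OF da db] V_def
    by (simp add: kdelta_commute[of j i] kdelta_commute[of l i] kdelta_commute[of l j] algebra_simps)
  have xV: "x \<bullet> V = 2 * (2 * a' * x $ i * x $ j + ((?b - a') * kdelta i j + b' * x $ i * x $ j) * ?q)"
  proof -
    have xx: "(\<Sum>l\<in>UNIV. x $ l * x $ l) = ?q" by (simp add: inner_vec_def)
    obtain b0 where b0: "b0 = ?b" by simp
    have "x \<bullet> V = 2 * (a' * (x $ i * (\<Sum>l\<in>UNIV. x $ l * kdelta j l) + x $ j * (\<Sum>l\<in>UNIV. x $ l * kdelta i l))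
       + ((?b - a') * kdelta i j + b' * x $ i * x $ j) * (\<Sum>l\<in>UNIV. x $ l * x $ l))"
      unfolding V_def inner_vec_def[of x "vec_lambda _"] b0[symmetric]
      by (simp add: sum_distrib_left sum.distrib[symmetric] algebra_simps)
    then show ?thesis by (simp add: sum_kdelta xx algebra_simps)
  qed
  have "christoffel G k i j x = (matrix_inv (G x) *v V) $ k / 2"
    unfolding christoffel_def V matrix_vector_mult_def by (simp add: V[symmetric])
  also have "\<dots> = (V $ k / ?a - ?b / (?a * c) * (x \<bullet> V) * x $ k) / 2"
    using a c unfolding G by (subst matrix_inv_radial_form) (simp_all add: radial_form_mult_vec)
  also have "\<dots> = radial_christoffel A B C k i j x"
  proof -
    \<comment> \<open>Trading bq for c - a removes q; the remaining identity holds over the common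
      denominator a c.\<close>
    have q: "?b * ?q = c - ?a" using c by simp
    have "?b * (x \<bullet> V)
      = 2 * (2 * a' * ?b * x $ i * x $ j + ((?b - a') * kdelta i j + b' * x $ i * x $ j) * (?b * ?q))"
      unfolding xV by (simp add: algebra_simps)
    then have s: "?b / (?a * c) * (x \<bullet> V) * x $ k
      = 2 * (2 * a' * ?b * x $ i * x $ j + ((?b - a') * kdelta i j + b' * x $ i * x $ j) * (c - ?a))
        / (?a * c) * x $ k"
      unfolding q by simp
    show ?thesis
      unfolding radial_christoffel_def A B C s using a c(2)
      by (simp add: V_def divide_simps) (simp add: algebra_simps)
  qed
  finally show ?thesis .
qed

section \<open>Curvature and Hessian of a radial form\<close>

text \<open>One contraction rule for the later index sums: a summand is first brought to this shape,
  with \<open>0 * kdelta\<close> filling in for an absent second delta.\<close>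

lemma sum_contract:
  fixes w x :: "real ^ 'n::finite"
  shows "(\<Sum>k\<in>UNIV. (a * kdelta i k + b * kdelta j k + c * x $ k) * w $ k)
    = a * w $ i + b * w $ j + c * (x \<bullet> w)"
proof -
  have "(\<Sum>k\<in>UNIV. (a * kdelta i k + b * kdelta j k + c * x $ k) * w $ k)
    = a * (\<Sum>k\<in>UNIV. kdelta i k * w $ k) + b * (\<Sum>k\<in>UNIV. kdelta j k * w $ k)
      + c * (\<Sum>k\<in>UNIV. x $ k * w $ k)"
    by (simp add: sum_distrib_left sum.distrib[symmetric] algebra_simps)
  then show ?thesis by (simp add: sum_kdelta inner_vec_def)
qed

lemma partial_radial_christoffel:
  fixes x :: "real ^ 'n::finite"
  assumes "(A has_real_derivative A') (at (x \<bullet> x))" "(B has_real_derivative B') (at (x \<bullet> x))"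
    "(C has_real_derivative C') (at (x \<bullet> x))"
  shows "partial i (radial_christoffel A B C l j k) x
    = 2 * A' * x $ i * (x $ j * kdelta k l + x $ k * kdelta j l)
      + A (x \<bullet> x) * (kdelta i j * kdelta k l + kdelta i k * kdelta j l)
      + 2 * B' * x $ i * x $ l * kdelta j k + B (x \<bullet> x) * kdelta i l * kdelta j k
      + 2 * C' * x $ i * x $ j * x $ k * x $ l
      + C (x \<bullet> x) * (kdelta i j * x $ k * x $ l + kdelta i k * x $ j * x $ l + kdelta i l * x $ j * x $ k)"
  unfolding radial_christoffel_def
  by (subst partialI, (rule derivative_intros has_derivative_vec_nth assms[THEN has_derivative_radial])+)
    (simp add: inner_axis axis_nth_kdelta algebra_simps)

text \<open>Taking for p the vector of symbols with upper index m and fixed j, k gives the quadratic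
  terms of the curvature tensor.\<close>

lemma sum_radial_christoffel:
  fixes x p :: "real ^ 'n::finite"
  shows "(\<Sum>m\<in>UNIV. radial_christoffel A B C l i m x * p $ m)
    = A (x \<bullet> x) * (x $ i * p $ l + kdelta i l * (x \<bullet> p)) + B (x \<bullet> x) * x $ l * p $ i
      + C (x \<bullet> x) * x $ i * x $ l * (x \<bullet> p)"
proof -
  have "radial_christoffel A B C l i m x = A (x \<bullet> x) * x $ i * kdelta l m + B (x \<bullet> x) * x $ l * kdelta i m
      + (A (x \<bullet> x) * kdelta i l + C (x \<bullet> x) * x $ i * x $ l) * x $ m" for m
    by (simp add: radial_christoffel_def kdelta_commute[of m l] algebra_simps)
  then have "(\<Sum>m\<in>UNIV. radial_christoffel A B C l i m x * p $ m)
    = A (x \<bullet> x) * x $ i * p $ l + B (x \<bullet> x) * x $ l * p $ i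
      + (A (x \<bullet> x) * kdelta i l + C (x \<bullet> x) * x $ i * x $ l) * (x \<bullet> p)"
    by (simp only: sum_contract)
  then show ?thesis by (simp add: algebra_simps)
qed

text \<open>This contraction occurs in the quadratic part of the curvature tensor and in the Hessian
  of a radial function, whose partial derivatives form a multiple of x.\<close>

lemma inner_radial_christoffel:
  fixes x :: "real ^ 'n::finite"
  shows "x \<bullet> (\<chi> m. radial_christoffel A B C m j k x)
    = 2 * A (x \<bullet> x) * x $ j * x $ k
      + (B (x \<bullet> x) * kdelta j k + C (x \<bullet> x) * x $ j * x $ k) * (x \<bullet> x)"
proof -
  have "radial_christoffel A B C m j k x = A (x \<bullet> x) * x $ k * kdelta j m + A (x \<bullet> x) * x $ j * kdelta k m
      + (B (x \<bullet> x) * kdelta j k + C (x \<bullet> x) * x $ j * x $ k) * x $ m" for m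
    by (simp add: radial_christoffel_def algebra_simps)
  then have "(\<Sum>m\<in>UNIV. radial_christoffel A B C m j k x * x $ m)
    = A (x \<bullet> x) * x $ k * x $ j + A (x \<bullet> x) * x $ j * x $ k
      + (B (x \<bullet> x) * kdelta j k + C (x \<bullet> x) * x $ j * x $ k) * (x \<bullet> x)"
    by (simp only: sum_contract)
  moreover have "x \<bullet> (\<chi> m. radial_christoffel A B C m j k x)
    = (\<Sum>m\<in>UNIV. radial_christoffel A B C m j k x * x $ m)"
    by (subst inner_commute) (simp add: inner_vec_def)
  ultimately show ?thesis by simp
qed

text \<open>Terms symmetric in i and j cancel, among them the one with C'. Three tensors
  antisymmetric in i and j remain, with coefficients P1, P2, P3.\<close>

lemma riemann_radial:
  fixes x :: "real ^ 'n::finite"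
  assumes chr: "\<And>k i j y. christoffel G k i j y = radial_christoffel A B C k i j y"
    and dA: "(A has_real_derivative A') (at (x \<bullet> x))" and dB: "(B has_real_derivative B') (at (x \<bullet> x))"
    and dC: "(C has_real_derivative C') (at (x \<bullet> x))"
    and P1: "P1 = B (x \<bullet> x) - A (x \<bullet> x) + A (x \<bullet> x) * B (x \<bullet> x) * (x \<bullet> x)"
    and P2: "P2 = - 2 * A' + C (x \<bullet> x) + (A (x \<bullet> x))\<^sup>2 + A (x \<bullet> x) * C (x \<bullet> x) * (x \<bullet> x)"
    and P3: "P3 = 2 * B' - C (x \<bullet> x) + (B (x \<bullet> x))\<^sup>2 + B (x \<bullet> x) * C (x \<bullet> x) * (x \<bullet> x)"
  shows "riemann G l i j k x = P1 * (kdelta l i * kdelta j k - kdelta l j * kdelta i k)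
    + P2 * x $ k * (x $ j * kdelta l i - x $ i * kdelta l j)
    + P3 * x $ l * (x $ i * kdelta j k - x $ j * kdelta i k)"
proof -
  have chr': "christoffel G k i j = radial_christoffel A B C k i j" for k i j
    using chr by auto
  have prod: "(\<Sum>m\<in>UNIV. radial_christoffel A B C l i m x * radial_christoffel A B C m j k x)
    = A (x \<bullet> x) * (x $ i * radial_christoffel A B C l j k x + kdelta i l * (2 * A (x \<bullet> x) * x $ j * x $ k
      + (B (x \<bullet> x) * kdelta j k + C (x \<bullet> x) * x $ j * x $ k) * (x \<bullet> x)))
      + B (x \<bullet> x) * x $ l * radial_christoffel A B C i j k x
      + C (x \<bullet> x) * x $ i * x $ l * (2 * A (x \<bullet> x) * x $ j * x $ k
      + (B (x \<bullet> x) * kdelta j k + C (x \<bullet> x) * x $ j * x $ k) * (x \<bullet> x))" for i j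
    using sum_radial_christoffel[of A B C l i x "\<chi> m. radial_christoffel A B C m j k x"]
    by (simp only: inner_radial_christoffel vec_lambda_beta)
  show ?thesis
    unfolding riemann_def chr' sum_subtractf prod partial_radial_christoffel[OF dA dB dC] P1 P2 P3
    by (simp add: radial_christoffel_def kdelta_commute[of j i] kdelta_commute[of k i] kdelta_commute[of k j]
        kdelta_commute[of i l] kdelta_commute[of j l] kdelta_commute[of k l]
        power2_eq_square algebra_simps)
qed

text \<open>The sums are contracted from the inside out, over k, then j, then i; after each, the
  terms are regrouped so that \<open>sum_contract\<close> applies again.\<close>

lemma curvature_vec_radial:
  fixes x :: "real ^ 'n::finite"
  assumes "\<And>l i j k. riemann G l i j k x = P1 * (kdelta l i * kdelta j k - kdelta l j * kdelta i k)
    + P2 * x $ k * (x $ j * kdelta l i - x $ i * kdelta l j)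
    + P3 * x $ l * (x $ i * kdelta j k - x $ j * kdelta i k)"
  shows "curvature_vec G x u v w = (P1 * (v \<bullet> w) + P2 * (x \<bullet> w) * (x \<bullet> v)) *\<^sub>R u
    - (P1 * (u \<bullet> w) + P2 * (x \<bullet> w) * (x \<bullet> u)) *\<^sub>R v
    + (P3 * ((x \<bullet> u) * (v \<bullet> w) - (x \<bullet> v) * (u \<bullet> w))) *\<^sub>R x"
proof -
  have k: "(\<Sum>k\<in>UNIV. riemann G l i j k x * u $ i * v $ j * w $ k)
    = (P1 * kdelta l i + P3 * x $ l * x $ i) * u $ i * v $ j * w $ j
      + (- P1 * kdelta l j - P3 * x $ l * x $ j) * u $ i * v $ j * w $ i
      + P2 * (x $ j * kdelta l i - x $ i * kdelta l j) * u $ i * v $ j * (x \<bullet> w)" for l i j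
  proof -
    have "riemann G l i j k x * u $ i * v $ j
      = ((- P1 * kdelta l j - P3 * x $ l * x $ j) * u $ i * v $ j) * kdelta i k
        + ((P1 * kdelta l i + P3 * x $ l * x $ i) * u $ i * v $ j) * kdelta j k
        + (P2 * (x $ j * kdelta l i - x $ i * kdelta l j) * u $ i * v $ j) * x $ k" for k
      unfolding assms by (simp add: algebra_simps)
    then show ?thesis by (simp only: sum_contract)
  qed
  have j: "(\<Sum>j\<in>UNIV. \<Sum>k\<in>UNIV. riemann G l i j k x * u $ i * v $ j * w $ k)
    = u $ i * ((P1 * (v \<bullet> w) + P2 * (x \<bullet> w) * (x \<bullet> v)) * kdelta l i
       + P3 * x $ l * (v \<bullet> w) * x $ i
       - P1 * w $ i * v $ l - P2 * (x \<bullet> w) * v $ l * x $ i - P3 * x $ l * (x \<bullet> v) * w $ i)" for l i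
  proof -
    have vw: "(\<Sum>j\<in>UNIV. v $ j * w $ j) = v \<bullet> w" by (simp add: inner_vec_def)
    have "(\<Sum>j\<in>UNIV. \<Sum>k\<in>UNIV. riemann G l i j k x * u $ i * v $ j * w $ k)
      = (P1 * kdelta l i + P3 * x $ l * x $ i) * u $ i * (\<Sum>j\<in>UNIV. v $ j * w $ j)
      + (\<Sum>j\<in>UNIV. ((- P1 * w $ i - P2 * (x \<bullet> w) * x $ i) * u $ i * kdelta l j + 0 * kdelta l j
        + (- P3 * x $ l * w $ i + P2 * (x \<bullet> w) * kdelta l i) * u $ i * x $ j) * v $ j)"
      unfolding k sum_distrib_left sum.distrib[symmetric]
      by (rule sum.cong) (simp_all add: algebra_simps)
    also have "\<dots> = (P1 * kdelta l i + P3 * x $ l * x $ i) * u $ i * (v \<bullet> w)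
      + ((- P1 * w $ i - P2 * (x \<bullet> w) * x $ i) * u $ i * v $ l + 0 * v $ l
        + (- P3 * x $ l * w $ i + P2 * (x \<bullet> w) * kdelta l i) * u $ i * (x \<bullet> v))"
      by (simp only: sum_contract vw)
    finally show ?thesis by (simp add: algebra_simps)
  qed
  have "(\<Sum>i\<in>UNIV. \<Sum>j\<in>UNIV. \<Sum>k\<in>UNIV. riemann G l i j k x * u $ i * v $ j * w $ k)
    = (\<Sum>i\<in>UNIV. ((P1 * (v \<bullet> w) + P2 * (x \<bullet> w) * (x \<bullet> v)) * kdelta l i + 0 * kdelta l i
       + (P3 * x $ l * (v \<bullet> w) - P2 * (x \<bullet> w) * v $ l) * x $ i) * u $ i)
      - (P1 * v $ l + P3 * x $ l * (x \<bullet> v)) * (u \<bullet> w)" (is "_ = ?r l") for l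
    unfolding inner_vec_def[of u w] inner_real_def j sum_distrib_left sum_subtractf[symmetric]
    by (rule sum.cong) (simp_all add: algebra_simps)
  then have "(\<Sum>i\<in>UNIV. \<Sum>j\<in>UNIV. \<Sum>k\<in>UNIV. riemann G l i j k x * u $ i * v $ j * w $ k)
    = (P1 * (v \<bullet> w) + P2 * (x \<bullet> w) * (x \<bullet> v)) * u $ l + 0 * u $ l
      + (P3 * x $ l * (v \<bullet> w) - P2 * (x \<bullet> w) * v $ l) * (x \<bullet> u)
      - (P1 * v $ l + P3 * x $ l * (x \<bullet> v)) * (u \<bullet> w)" for l
    by (simp only: sum_contract)
  then show ?thesis
    by (simp add: vec_eq_iff curvature_vec_def algebra_simps)
qed

text \<open>The second hypothesis says that the curvature tensor with its upper index lowered is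
  antisymmetric in k and l. It makes the result symmetric in u and v.\<close>

lemma inner_coord_curvature_radial:
  fixes x :: "real ^ 'n::finite"
  assumes "\<And>l i j k. riemann (radial_form a b) l i j k x
      = P1 * (kdelta l i * kdelta j k - kdelta l j * kdelta i k)
    + P2 * x $ k * (x $ j * kdelta l i - x $ i * kdelta l j)
    + P3 * x $ l * (x $ i * kdelta j k - x $ j * kdelta i k)"
    and "a (x \<bullet> x) * P2 = (a (x \<bullet> x) + b (x \<bullet> x) * (x \<bullet> x)) * P3 + b (x \<bullet> x) * P1"
  shows "inner_coord (radial_form a b x) (curvature_vec (radial_form a b) x u v v) u
    = a (x \<bullet> x) * P1 * ((u \<bullet> u) * (v \<bullet> v) - (u \<bullet> v)\<^sup>2)
      + a (x \<bullet> x) * P2 * ((x \<bullet> u)\<^sup>2 * (v \<bullet> v) + (x \<bullet> v)\<^sup>2 * (u \<bullet> u) - 2 * (x \<bullet> u) * (x \<bullet> v) * (u \<bullet> v))"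
proof -
  have "inner_coord (radial_form a b x) (curvature_vec (radial_form a b) x u v v) u
    = a (x \<bullet> x) * P1 * ((u \<bullet> u) * (v \<bullet> v) - (u \<bullet> v)\<^sup>2)
      + a (x \<bullet> x) * P2 * ((x \<bullet> v)\<^sup>2 * (u \<bullet> u) - (x \<bullet> u) * (x \<bullet> v) * (u \<bullet> v))
      + ((a (x \<bullet> x) + b (x \<bullet> x) * (x \<bullet> x)) * P3 + b (x \<bullet> x) * P1)
        * ((x \<bullet> u)\<^sup>2 * (v \<bullet> v) - (x \<bullet> u) * (x \<bullet> v) * (u \<bullet> v))"
    unfolding curvature_vec_radial[OF assms(1)] inner_coord_radial_form
    by (simp add: inner_simps inner_commute[of v u] power2_eq_square algebra_simps)
  then show ?thesis unfolding assms(2)[symmetric] by (simp add: algebra_simps)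
qed

text \<open>The second partial derivatives are 4 F'' x_i x_j + 2 F' \<open>kdelta i j\<close>; the
  Christoffel term subtracts 2 F' times the contraction of x with the symbols. \<open>dF\<close>
  ranges over all y because the first derivative is differentiated again.\<close>

lemma hess_coord_radial:
  fixes x :: "real ^ 'n::finite"
  assumes chr: "\<And>k i j y. christoffel G k i j y = radial_christoffel A B C k i j y"
    and dF: "\<And>y :: real ^ 'n. (F has_real_derivative F' (y \<bullet> y)) (at (y \<bullet> y))"
    and dF': "(F' has_real_derivative F'') (at (x \<bullet> x))"
  shows "hess_coord G (\<lambda>y. F (y \<bullet> y)) x u v
    = 2 * F' (x \<bullet> x) * (1 - B (x \<bullet> x) * (x \<bullet> x)) * (u \<bullet> v)
      + (4 * F'' - 2 * F' (x \<bullet> x) * (2 * A (x \<bullet> x) + C (x \<bullet> x) * (x \<bullet> x))) * (x \<bullet> u) * (x \<bullet> v)"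
    (is "_ = ?M * _ + ?S * _ * _")
proof -
  have p1: "partial j (\<lambda>y. F (y \<bullet> y)) = (\<lambda>y. F' (y \<bullet> y) * (2 * y $ j))" for j :: 'n
  proof
    fix y
    show "partial j (\<lambda>y. F (y \<bullet> y)) y = F' (y \<bullet> y) * (2 * y $ j)"
      using partialI[OF has_derivative_radial[OF dF[of y]], of j] by (simp add: inner_axis)
  qed
  have p2: "partial i (\<lambda>y. F' (y \<bullet> y) * (2 * y $ j)) x
    = 4 * F'' * x $ i * x $ j + 2 * F' (x \<bullet> x) * kdelta i j" for i j
    by (subst partialI, (rule derivative_intros has_derivative_vec_nth dF'[THEN has_derivative_radial])+)
      (simp add: inner_axis axis_nth_kdelta)
  have s: "(\<Sum>k\<in>UNIV. christoffel G k i j x * (F' (x \<bullet> x) * (2 * x $ k)))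
    = 2 * F' (x \<bullet> x) * (2 * A (x \<bullet> x) * x $ i * x $ j
      + (B (x \<bullet> x) * kdelta i j + C (x \<bullet> x) * x $ i * x $ j) * (x \<bullet> x))" for i j
  proof -
    have "(\<Sum>k\<in>UNIV. christoffel G k i j x * (F' (x \<bullet> x) * (2 * x $ k)))
      = 2 * F' (x \<bullet> x) * (\<Sum>k\<in>UNIV. x $ k * radial_christoffel A B C k i j x)"
      unfolding chr sum_distrib_left by (rule sum.cong) simp_all
    also have "(\<Sum>k\<in>UNIV. x $ k * radial_christoffel A B C k i j x)
      = x \<bullet> (\<chi> k. radial_christoffel A B C k i j x)"
      by (simp add: inner_vec_def[of _ "vec_lambda _"])
    finally show ?thesis unfolding inner_radial_christoffel .
  qed
  have "hess_coord G (\<lambda>y. F (y \<bullet> y)) x u v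
    = (\<Sum>i\<in>UNIV. \<Sum>j\<in>UNIV. (?M * u $ i * kdelta i j + 0 * kdelta i j + ?S * x $ i * u $ i * x $ j) * v $ j)"
    unfolding hess_coord_def p1 p2 s
    by (intro sum.cong) (simp_all add: algebra_simps)
  also have "\<dots> = ?M * (\<Sum>i\<in>UNIV. u $ i * v $ i) + ?S * (x \<bullet> v) * (\<Sum>i\<in>UNIV. x $ i * u $ i)"
    unfolding sum_contract sum_distrib_left sum.distrib[symmetric]
    by (rule sum.cong) (simp_all add: algebra_simps)
  also have "\<dots> = ?M * (u \<bullet> v) + ?S * (x \<bullet> u) * (x \<bullet> v)"
    by (simp add: inner_vec_def[of u v] inner_vec_def[of x u])
  finally show ?thesis .
qed

section \<open>The explicit metric in a stereographic chart\<close>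

text \<open>The quotient rule after cancelling a power of 1 + q, so that the exponent of the
  denominator grows by one only.\<close>

lemma DERIV_divide_power:
  fixes p :: "real \<Rightarrow> real"
  assumes "(p has_real_derivative p') (at q)" "1 + q \<noteq> 0"
  shows "((\<lambda>q. p q / (1 + q) ^ n) has_real_derivative ((1 + q) * p' - real n * p q) / (1 + q) ^ Suc n) (at q)"
proof (cases n)
  case (Suc m)
  have "((\<lambda>q. p q / (1 + q) ^ n) has_real_derivative
    (p' * (1 + q) ^ n - p q * (real n * (1 + q) ^ m)) / ((1 + q) ^ n * (1 + q) ^ n)) (at q)"
    by (rule derivative_eq_intros refl assms)+ (use assms Suc in simp_all)
  also have "(p' * (1 + q) ^ n - p q * (real n * (1 + q) ^ m)) / ((1 + q) ^ n * (1 + q) ^ n)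
    = ((1 + q) * p' - real n * p q) / (1 + q) ^ Suc n"
    using assms(2) unfolding Suc by (simp add: divide_simps) (simp add: algebra_simps)
  finally show ?thesis .
qed (use assms in simp)

text \<open>
  With \<open>w = 1 + q\<close> and \<open>t = 4q/w\<^sup>2\<close>, one has \<open>1 + t/4 = N/w\<^sup>2\<close>; the radial eigenvalue \<open>a + bq\<close> is that of
  the round metric, \<open>4/w\<^sup>2\<close>.
\<close>

definition met_N :: "real \<Rightarrow> real" where "met_N q = q\<^sup>2 + 3 * q + 1"

definition met_a :: "real \<Rightarrow> real" where
  "met_a q = 4 * (met_N q)\<^sup>2 / (1 + q) ^ 6"

definition met_b :: "real \<Rightarrow> real" where
  "met_b q = - 4 * (2 * (1 + q)\<^sup>2 + q) / (1 + q) ^ 6"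

text \<open>\<open>chr_A\<close>, \<open>chr_B\<close> and \<open>chr_C\<close> are the coefficients
  of \<open>christoffel_radial_form\<close> for this metric after cancellation;
  \<open>chr_A_christoffel\<close> and its two companions confirm this.\<close>

definition chr_A :: "real \<Rightarrow> real" where
  "chr_A q = - 2 * q * (q + 4) / ((1 + q) * met_N q)"

definition chr_B :: "real \<Rightarrow> real" where
  "chr_B q = (2 * q ^ 4 + 12 * q ^ 3 + 19 * q\<^sup>2 + q - 2) / (1 + q) ^ 5"

definition chr_C :: "real \<Rightarrow> real" where
  "chr_C q = (1 - q) * (7 * q\<^sup>2 + 17 * q + 7) / ((1 + q) ^ 5 * met_N q)"

section \<open>Derivatives, Christoffel and curvature coefficients as rational functions of
  q\<close>

context
  fixes q w N :: real
  assumes q: "0 \<le> q" and w: "w = 1 + q" and N: "N = met_N q"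
begin

lemma met_pos: "0 < w" "0 < N"
  using q by (auto simp: w N met_N_def intro: add_nonneg_pos)

lemma met_N_eq: "N = w\<^sup>2 + q"
  by (simp add: w N met_N_def power2_eq_square algebra_simps)

lemma met_a_eq: "met_a q = 4 * N\<^sup>2 / w ^ 6"
  by (simp add: met_a_def w N)

lemma met_b_eq: "met_b q = - 4 * (2 * w\<^sup>2 + q) / w ^ 6"
  by (simp add: met_b_def w)

lemma chr_A_eq: "chr_A q = - 2 * q * (q + 4) / (w * N)"
  by (simp add: chr_A_def w N)

lemma chr_B_eq: "chr_B q = (2 * q ^ 4 + 12 * q ^ 3 + 19 * q\<^sup>2 + q - 2) / w ^ 5"
  by (simp add: chr_B_def w)

lemma chr_C_eq: "chr_C q = (1 - q) * (7 * q\<^sup>2 + 17 * q + 7) / (w ^ 5 * N)"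
  by (simp add: chr_C_def w N)

lemma met_c_eq: "met_a q + met_b q * q = 4 / w\<^sup>2"
proof -
  have "N\<^sup>2 - (2 * w\<^sup>2 + q) * q = w ^ 4" unfolding met_N_eq by algebra
  then have "met_a q + met_b q * q = 4 * w ^ 4 / w ^ 6"
    unfolding met_a_eq met_b_eq by (simp add: add_divide_distrib[symmetric] diff_divide_distrib[symmetric] algebra_simps)
  then show ?thesis using met_pos by (simp add: field_simps power_eq_if[of w])
qed

lemma DERIV_met_a: "(met_a has_real_derivative - 8 * q * (q + 4) * N / w ^ 7) (at q)"
proof -
  have "((\<lambda>q. 4 * (met_N q)\<^sup>2) has_real_derivative 8 * N * (2 * q + 3)) (at q)"
    unfolding met_N_def N by (auto intro!: derivative_eq_intros)
  from DERIV_divide_power[OF this, of 6]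
  have "(met_a has_real_derivative (w * (8 * N * (2 * q + 3)) - 6 * (4 * N\<^sup>2)) / w ^ 7) (at q)"
    using met_pos by (simp add: w N met_a_def[abs_def])
  also have "w * (8 * N * (2 * q + 3)) - 6 * (4 * N\<^sup>2) = - 8 * q * (q + 4) * N"
    unfolding w N met_N_def by algebra
  finally show ?thesis .
qed

lemma DERIV_met_b: "(met_b has_real_derivative 4 * (8 * q\<^sup>2 + 21 * q + 7) / w ^ 7) (at q)"
proof -
  have "((\<lambda>q. - 4 * (2 * (1 + q)\<^sup>2 + q)) has_real_derivative - 4 * (4 * q + 5)) (at q)"
    by (auto intro!: derivative_eq_intros)
  from DERIV_divide_power[OF this, of 6]
  have "(met_b has_real_derivative (w * (- 4 * (4 * q + 5)) - 6 * (- 4 * (2 * w\<^sup>2 + q))) / w ^ 7) (at q)"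
    using met_pos by (simp add: w met_b_def[abs_def])
  also have "w * (- 4 * (4 * q + 5)) - 6 * (- 4 * (2 * w\<^sup>2 + q)) = 4 * (8 * q\<^sup>2 + 21 * q + 7)"
    unfolding w by algebra
  finally show ?thesis .
qed

lemma chr_A_christoffel: "chr_A q = (- 8 * q * (q + 4) * N / w ^ 7) / met_a q"
  unfolding chr_A_eq met_a_eq using met_pos
  by (simp add: divide_simps) (simp add: eval_nat_numeral)

text \<open>The numerators agree by a polynomial identity in q. Denominators are cleared separately,
  with w and N as atoms, which keeps the degrees low; the harder identities below are split in the
  same way.\<close>

lemma chr_B_christoffel:
  "chr_B q = (met_b q - (- 8 * q * (q + 4) * N / w ^ 7)) / (4 / w\<^sup>2)"
proof -
  have "- (2 * w\<^sup>2 + q) * w + 2 * q * (q + 4) * N = 2 * q ^ 4 + 12 * q ^ 3 + 19 * q\<^sup>2 + q - 2"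
    unfolding w N met_N_def by algebra
  moreover have "(met_b q - (- 8 * q * (q + 4) * N / w ^ 7)) / (4 / w\<^sup>2)
    = (- (2 * w\<^sup>2 + q) * w + 2 * q * (q + 4) * N) / w ^ 5"
    unfolding met_b_eq using met_pos by (simp add: divide_simps) algebra
  ultimately show ?thesis unfolding chr_B_eq by (simp only:)
qed

lemma chr_C_christoffel:
  "chr_C q = (4 * (8 * q\<^sup>2 + 21 * q + 7) / w ^ 7
    - 2 * (- 8 * q * (q + 4) * N / w ^ 7) * met_b q / met_a q) / (4 / w\<^sup>2)"
proof -
  have "(8 * q\<^sup>2 + 21 * q + 7) * N - 4 * q * (q + 4) * (2 * w\<^sup>2 + q)
    = (1 - q) * (7 * q\<^sup>2 + 17 * q + 7)"
    unfolding w N met_N_def by algebra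
  moreover have "(4 * (8 * q\<^sup>2 + 21 * q + 7) / w ^ 7
    - 2 * (- 8 * q * (q + 4) * N / w ^ 7) * met_b q / met_a q) / (4 / w\<^sup>2)
    = ((8 * q\<^sup>2 + 21 * q + 7) * N - 4 * q * (q + 4) * (2 * w\<^sup>2 + q)) / (w ^ 5 * N)"
    unfolding met_a_eq met_b_eq using met_pos by (simp add: divide_simps) algebra
  ultimately show ?thesis unfolding chr_C_eq by simp
qed

lemma DERIV_chr_A:
  "(chr_A has_real_derivative (- (4 * q + 8) * (w * N) + 2 * q * (q + 4) * (N + w * (2 * q + 3))) / (w * N)\<^sup>2) (at q)"
proof -
  have "((\<lambda>q. - 2 * q * (q + 4)) has_real_derivative - (4 * q + 8)) (at q)"
    by (auto intro!: derivative_eq_intros)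
  moreover have "((\<lambda>q. (1 + q) * met_N q) has_real_derivative N + w * (2 * q + 3)) (at q)"
    unfolding met_N_def N w by (auto intro!: derivative_eq_intros)
  moreover have "(1 + q) * met_N q \<noteq> 0" using met_pos by (simp add: w N)
  ultimately show ?thesis
    unfolding chr_A_def[abs_def] by (rule DERIV_cong[OF DERIV_divide]) (simp add: w N power2_eq_square)
qed

lemma DERIV_chr_B:
  "(chr_B has_real_derivative
    (w * (8 * q ^ 3 + 36 * q\<^sup>2 + 38 * q + 1) - 5 * (2 * q ^ 4 + 12 * q ^ 3 + 19 * q\<^sup>2 + q - 2)) / w ^ 6) (at q)"
proof -
  have "((\<lambda>q. 2 * q ^ 4 + 12 * q ^ 3 + 19 * q\<^sup>2 + q - 2) has_real_derivative
    8 * q ^ 3 + 36 * q\<^sup>2 + 38 * q + 1) (at q)"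
    by (auto intro!: derivative_eq_intros)
  from DERIV_divide_power[OF this, of 5] show ?thesis
    using met_pos by (simp add: w chr_B_def[abs_def])
qed

text \<open>Existence without a value: the derivative of C cancels from the curvature in
  \<open>riemann_radial\<close>.\<close>

lemma DERIV_chr_C: "\<exists>C'. (chr_C has_real_derivative C') (at q)"
proof -
  have "(1 + q) ^ 5 * met_N q \<noteq> 0" using met_pos by (simp add: w N)
  then show ?thesis
    unfolding chr_C_def[abs_def] met_N_def
    by (intro exI) (rule derivative_eq_intros refl | assumption)+
qed

text \<open>With t = 4q/w^2 the numerator is w^4 (9t^2 + 15t - 8)/4, so this is
  \<open>met_a q\<close> times the tangential curvature.\<close>

lemma riemann_coeff1: "chr_B q - chr_A q + chr_A q * chr_B q * q
  = (- 2 * w ^ 4 + 15 * q * w\<^sup>2 + 36 * q\<^sup>2) / w ^ 6"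
proof -
  let ?B = "2 * q ^ 4 + 12 * q ^ 3 + 19 * q\<^sup>2 + q - 2"
  have "?B * (w * N) + 2 * q * (q + 4) * w ^ 5 - 2 * q * (q + 4) * ?B * q
    = (- 2 * w ^ 4 + 15 * q * w\<^sup>2 + 36 * q\<^sup>2) * N"
    unfolding w N met_N_def by algebra
  moreover have "chr_B q - chr_A q + chr_A q * chr_B q * q
    = (?B * (w * N) + 2 * q * (q + 4) * w ^ 5 - 2 * q * (q + 4) * ?B * q) / (w ^ 6 * N)"
    unfolding chr_A_eq chr_B_eq using met_pos by (simp add: divide_simps) algebra
  ultimately show ?thesis using met_pos by simp
qed

lemma riemann_coeff2:
  "- 2 * ((- (4 * q + 8) * (w * N) + 2 * q * (q + 4) * (N + w * (2 * q + 3))) / (w * N)\<^sup>2)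
    + chr_C q + (chr_A q)\<^sup>2 + chr_A q * chr_C q * q
  = (23 * w ^ 4 - 51 * q * w\<^sup>2 - 36 * q\<^sup>2) / (w ^ 6 * N)"
proof -
  let ?C = "(1 - q) * (7 * q\<^sup>2 + 17 * q + 7)" and ?A = "- 2 * q * (q + 4)"
  let ?D = "- (4 * q + 8) * (w * N) + 2 * q * (q + 4) * (N + w * (2 * q + 3))"
  have "- 2 * ?D * w ^ 4 + ?C * w * N + ?A\<^sup>2 * w ^ 4 + ?A * ?C * q
    = (23 * w ^ 4 - 51 * q * w\<^sup>2 - 36 * q\<^sup>2) * N"
    unfolding w N met_N_def by algebra
  moreover have "- 2 * (?D / (w * N)\<^sup>2) + chr_C q + (chr_A q)\<^sup>2 + chr_A q * chr_C q * q
    = (- 2 * ?D * w ^ 4 + ?C * w * N + ?A\<^sup>2 * w ^ 4 + ?A * ?C * q) / (w ^ 6 * N\<^sup>2)"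
    unfolding chr_A_eq chr_C_eq using met_pos
    by (simp add: divide_simps power_mult_distrib) algebra
  ultimately show ?thesis using met_pos by (simp add: power2_eq_square)
qed

lemma riemann_coeff3:
  "2 * ((w * (8 * q ^ 3 + 36 * q\<^sup>2 + 38 * q + 1) - 5 * (2 * q ^ 4 + 12 * q ^ 3 + 19 * q\<^sup>2 + q - 2)) / w ^ 6)
    - chr_C q + (chr_B q)\<^sup>2 + chr_B q * chr_C q * q = 19 / w ^ 4"
proof -
  let ?C = "(1 - q) * (7 * q\<^sup>2 + 17 * q + 7)" and ?B = "2 * q ^ 4 + 12 * q ^ 3 + 19 * q\<^sup>2 + q - 2"
  let ?D = "w * (8 * q ^ 3 + 36 * q\<^sup>2 + 38 * q + 1) - 5 * (2 * q ^ 4 + 12 * q ^ 3 + 19 * q\<^sup>2 + q - 2)"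
  have "2 * ?D * w ^ 4 * N - ?C * w ^ 5 + ?B\<^sup>2 * N + ?B * ?C * q = 19 * w ^ 6 * N"
    unfolding w N met_N_def by algebra
  moreover have "2 * (?D / w ^ 6) - chr_C q + (chr_B q)\<^sup>2 + chr_B q * chr_C q * q
    = (2 * ?D * w ^ 4 * N - ?C * w ^ 5 + ?B\<^sup>2 * N + ?B * ?C * q) / (w ^ 10 * N)"
    unfolding chr_B_eq chr_C_eq using met_pos
    by (simp add: divide_simps power_mult_distrib) algebra
  ultimately show ?thesis using met_pos by (simp add: divide_simps) algebra
qed

text \<open>The antisymmetry hypothesis of \<open>inner_coord_curvature_radial\<close> for the three
  coefficients just found.\<close>

lemma riemann_coeff_relation:
  "met_a q * ((23 * w ^ 4 - 51 * q * w\<^sup>2 - 36 * q\<^sup>2) / (w ^ 6 * N))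
    = 4 / w\<^sup>2 * (19 / w ^ 4) + met_b q * ((- 2 * w ^ 4 + 15 * q * w\<^sup>2 + 36 * q\<^sup>2) / w ^ 6)"
proof -
  have "N * (23 * w ^ 4 - 51 * q * w\<^sup>2 - 36 * q\<^sup>2)
    = 19 * w ^ 6 - (2 * w\<^sup>2 + q) * (- 2 * w ^ 4 + 15 * q * w\<^sup>2 + 36 * q\<^sup>2)"
    unfolding w N met_N_def by algebra
  moreover have "met_a q * ((23 * w ^ 4 - 51 * q * w\<^sup>2 - 36 * q\<^sup>2) / (w ^ 6 * N))
    = 4 * (N * (23 * w ^ 4 - 51 * q * w\<^sup>2 - 36 * q\<^sup>2)) / w ^ 12"
    unfolding met_a_eq using met_pos by (simp add: divide_simps) algebra
  ultimately show ?thesis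
    unfolding met_b_eq using met_pos by (simp add: divide_simps) algebra
qed

end

text \<open>uu, uv, vv, X, Y stand for the Euclidean products of u, v and x. A radial unit vector is
  x divided by the square root of cq, so A0 and B0 are the squared radial components of u and
  v.\<close>

lemma weighted_curvature_combination_pos:
  fixes a b c q uu uv vv X Y kt kr mu fr :: real
  assumes q: "0 < q" and c: "0 < c" and a: "0 < a" and b: "b * q = c - a"
    and on: "a * uu + b * X\<^sup>2 = 1" "a * vv + b * Y\<^sup>2 = 1" "a * uv + b * X * Y = 0"
    and gram: "X\<^sup>2 * vv + Y\<^sup>2 * uu - 2 * X * Y * uv \<le> q * (uu * vv - uv\<^sup>2)"
    and P2: "q * P2 = c * kr - a * kt" and S: "q * S = c * fr - a * mu"
    and pos: "0 < kr + fr" "0 < kr + mu" "0 < kt + mu"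
  shows "0 < a * (a * kt) * (uu * vv - uv\<^sup>2) + a * P2 * (X\<^sup>2 * vv + Y\<^sup>2 * uu - 2 * X * Y * uv)
    + a * mu * vv + S * Y\<^sup>2"
proof -
  define A0 B0 where "A0 = c * X\<^sup>2 / q" and "B0 = c * Y\<^sup>2 / q"
  have W: "a\<^sup>2 * (uu * vv - uv\<^sup>2) = 1 - b * (X\<^sup>2 + Y\<^sup>2)" using on by algebra
  have E: "a * (X\<^sup>2 * vv + Y\<^sup>2 * uu - 2 * X * Y * uv) = X\<^sup>2 + Y\<^sup>2" using on by algebra
  have ge: "0 \<le> A0" "0 \<le> B0" using q c by (simp_all add: A0_def B0_def)
  have AB: "q * A0 = c * X\<^sup>2" "q * B0 = c * Y\<^sup>2" using q by (simp_all add: A0_def B0_def)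
  \<comment> \<open>\<open>gram\<close>, scaled by a^2, turns into A0 + B0 \<le> 1, which is
    Bessel's inequality for the radial unit vector.\<close>
  have "a * (a * (X\<^sup>2 * vv + Y\<^sup>2 * uu - 2 * X * Y * uv)) \<le> q * (a\<^sup>2 * (uu * vv - uv\<^sup>2))"
    using mult_left_mono[OF gram, of "a\<^sup>2"] a by (simp add: power2_eq_square algebra_simps)
  then have "a * (X\<^sup>2 + Y\<^sup>2) \<le> q - (c - a) * (X\<^sup>2 + Y\<^sup>2)"
    unfolding W E b[symmetric] by (simp add: algebra_simps)
  then have "q * (A0 + B0) \<le> q * 1" using AB by (simp add: algebra_simps)
  then have le: "A0 + B0 \<le> 1" using q by (simp only: mult_le_cancel_left_pos)
  \<comment> \<open>P2, S and b are known only through their products with q, hence the factor q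
    until all three are replaced.\<close>
  have "q * (a * (a * kt) * (uu * vv - uv\<^sup>2) + a * P2 * (X\<^sup>2 * vv + Y\<^sup>2 * uu - 2 * X * Y * uv)
    + a * mu * vv + S * Y\<^sup>2)
    = q * kt * (a\<^sup>2 * (uu * vv - uv\<^sup>2)) + q * P2 * (a * (X\<^sup>2 * vv + Y\<^sup>2 * uu - 2 * X * Y * uv))
    + mu * q * (a * vv) + q * S * Y\<^sup>2" by algebra
  also have "\<dots> = q * ((1 - A0 - B0) * (kt + mu) + B0 * (kr + fr) + A0 * (kr + mu))"
    unfolding W E P2 S using AB b on(2) by algebra
  finally have "a * (a * kt) * (uu * vv - uv\<^sup>2) + a * P2 * (X\<^sup>2 * vv + Y\<^sup>2 * uu - 2 * X * Y * uv)
    + a * mu * vv + S * Y\<^sup>2 = (1 - A0 - B0) * (kt + mu) + B0 * (kr + fr) + A0 * (kr + mu)"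
    using q by simp
  moreover define m where "m = min (kt + mu) (min (kr + fr) (kr + mu))"
  moreover have "(1 - A0 - B0) * m + B0 * m + A0 * m
    \<le> (1 - A0 - B0) * (kt + mu) + B0 * (kr + fr) + A0 * (kr + mu)"
    using ge le by (intro add_mono mult_left_mono) (auto simp: m_def)
  moreover have "(1 - A0 - B0) * m + B0 * m + A0 * m = m" by (simp add: algebra_simps)
  moreover have "0 < m" using pos by (simp add: m_def)
  ultimately show ?thesis by linarith
qed

text \<open>Nonnegativity of the Gram determinant of x, u, v. It is the Cauchy-Schwarz inequality
  for the parts of u and v orthogonal to x, scaled by q to avoid fractions.\<close>

lemma gram_determinant:
  fixes x u v :: "'a::real_inner"
  shows "(x \<bullet> u)\<^sup>2 * (v \<bullet> v) + (x \<bullet> v)\<^sup>2 * (u \<bullet> u) - 2 * (x \<bullet> u) * (x \<bullet> v) * (u \<bullet> v)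
    \<le> (x \<bullet> x) * ((u \<bullet> u) * (v \<bullet> v) - (u \<bullet> v)\<^sup>2)"
proof (cases "x = 0")
  case False
  define q where "q = x \<bullet> x"
  have q: "0 < q" using False by (simp add: q_def)
  define u' v' where "u' = q *\<^sub>R u - (x \<bullet> u) *\<^sub>R x" and "v' = q *\<^sub>R v - (x \<bullet> v) *\<^sub>R x"
  have "(u' \<bullet> v')\<^sup>2 \<le> (u' \<bullet> u') * (v' \<bullet> v')" by (rule Cauchy_Schwarz_ineq)
  moreover have "u' \<bullet> v' = q * (q * (u \<bullet> v) - (x \<bullet> u) * (x \<bullet> v))"
    "u' \<bullet> u' = q * (q * (u \<bullet> u) - (x \<bullet> u)\<^sup>2)" "v' \<bullet> v' = q * (q * (v \<bullet> v) - (x \<bullet> v)\<^sup>2)"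
    by (simp_all add: u'_def v'_def inner_simps inner_commute q_def[symmetric] power2_eq_square algebra_simps)
  ultimately have "0 \<le> q\<^sup>2 * ((q * (u \<bullet> u) - (x \<bullet> u)\<^sup>2) * (q * (v \<bullet> v) - (x \<bullet> v)\<^sup>2)
    - (q * (u \<bullet> v) - (x \<bullet> u) * (x \<bullet> v))\<^sup>2)"
    by (simp add: power2_eq_square algebra_simps)
  also have "\<dots> = q ^ 3 * (q * ((u \<bullet> u) * (v \<bullet> v) - (u \<bullet> v)\<^sup>2)
    - ((x \<bullet> u)\<^sup>2 * (v \<bullet> v) + (x \<bullet> v)\<^sup>2 * (u \<bullet> u) - 2 * (x \<bullet> u) * (x \<bullet> v) * (u \<bullet> v)))"
    by algebra
  finally show ?thesis using q by (simp add: zero_le_mult_iff flip: q_def)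
qed simp

section \<open>Weighted curvature in the chart\<close>

lemma christoffel_met:
  fixes y :: "real ^ 'n::finite"
  shows "christoffel (radial_form met_a met_b) k i j y = radial_christoffel chr_A chr_B chr_C k i j y"
proof -
  have q: "0 \<le> y \<bullet> y" by simp
  note ctx = q refl refl
  have "met_a (y \<bullet> y) \<noteq> 0" using met_pos[OF ctx] by (simp add: met_a_eq[OF ctx])
  moreover have "4 / (1 + y \<bullet> y)\<^sup>2 \<noteq> 0" using met_pos[OF ctx] by simp
  ultimately show ?thesis
    by (intro christoffel_radial_form[OF refl DERIV_met_a[OF ctx] DERIV_met_b[OF ctx] _
          met_c_eq[OF ctx, symmetric]] chr_A_christoffel[OF ctx] chr_B_christoffel[OF ctx]
          chr_C_christoffel[OF ctx])
qed

text \<open>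
  \<open>curv_tan\<close> and \<open>curv_rad\<close>, \<open>hess_tan\<close> and \<open>hess_rad\<close> are the curvatures and Hessian eigenvalues named
  in the introduction, as functions of q.  \<open>curv_mix\<close> and \<open>hess_mix\<close> are what remains of their
  differences after division by q, so that the formulas stay valid at the origin of the chart.
\<close>

definition curv_tan :: "real \<Rightarrow> real" where
  "curv_tan q = (- 2 * (1 + q) ^ 4 + 15 * q * (1 + q)\<^sup>2 + 36 * q\<^sup>2) / (4 * (met_N q)\<^sup>2)"

definition curv_mix :: "real \<Rightarrow> real" where
  "curv_mix q = (23 * (1 + q) ^ 4 - 51 * q * (1 + q)\<^sup>2 - 36 * q\<^sup>2) / ((1 + q) ^ 6 * met_N q)"

lemma inner_coord_curvature_met:
  fixes x :: "real ^ 'n::finite"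
  shows "inner_coord (radial_form met_a met_b x) (curvature_vec (radial_form met_a met_b) x u v v) u
    = met_a (x \<bullet> x) * (met_a (x \<bullet> x) * curv_tan (x \<bullet> x)) * ((u \<bullet> u) * (v \<bullet> v) - (u \<bullet> v)\<^sup>2)
      + met_a (x \<bullet> x) * curv_mix (x \<bullet> x)
        * ((x \<bullet> u)\<^sup>2 * (v \<bullet> v) + (x \<bullet> v)\<^sup>2 * (u \<bullet> u) - 2 * (x \<bullet> u) * (x \<bullet> v) * (u \<bullet> v))"
proof -
  have q: "0 \<le> x \<bullet> x" by simp
  note ctx = q refl refl
  obtain C' where C': "(chr_C has_real_derivative C') (at (x \<bullet> x))" using DERIV_chr_C[OF ctx] by blast
  have P1: "met_a (x \<bullet> x) * curv_tan (x \<bullet> x)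
    = (- 2 * (1 + x \<bullet> x) ^ 4 + 15 * (x \<bullet> x) * (1 + x \<bullet> x)\<^sup>2 + 36 * (x \<bullet> x)\<^sup>2) / (1 + x \<bullet> x) ^ 6"
    using met_pos[OF ctx] by (simp add: met_a_eq[OF ctx] curv_tan_def)
  note R = riemann_radial[OF christoffel_met DERIV_chr_A[OF ctx] DERIV_chr_B[OF ctx] C'
      riemann_coeff1[OF ctx, symmetric] riemann_coeff2[OF ctx, symmetric] riemann_coeff3[OF ctx, symmetric]]
  show ?thesis
    unfolding P1 curv_mix_def
    by (rule inner_coord_curvature_radial[OF R]) (simp only: met_c_eq[OF ctx] riemann_coeff_relation[OF ctx])
qed

section \<open>The density t/2 with t = 4q/(1 + q)^2, and its Hessian\<close>

definition dens :: "real \<Rightarrow> real" where "dens q = 2 * q / (1 + q)\<^sup>2"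

definition dens_deriv :: "real \<Rightarrow> real" where "dens_deriv q = 2 * (1 - q) / (1 + q) ^ 3"

lemma DERIV_dens: "0 \<le> q \<Longrightarrow> (dens has_real_derivative dens_deriv q) (at q)"
  using DERIV_divide_power[of "\<lambda>q. 2 * q" 2 q 2]
  by (auto simp: dens_def[abs_def] dens_deriv_def intro!: derivative_eq_intros)

lemma DERIV_dens_deriv: "0 \<le> q \<Longrightarrow> (dens_deriv has_real_derivative 4 * (q - 2) / (1 + q) ^ 4) (at q)"
proof -
  assume q: "0 \<le> q"
  have "((\<lambda>q. 2 * (1 - q)) has_real_derivative - 2) (at q)"
    by (auto intro!: derivative_eq_intros)
  from DERIV_divide_power[OF this, of 3] show ?thesis
    using q by (simp add: dens_deriv_def[abs_def] algebra_simps)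
qed

definition hess_tan :: "real \<Rightarrow> real" where
  "hess_tan q = (1 - q)\<^sup>2 * ((1 + q)\<^sup>2 + 3 * q) / ((1 + q)\<^sup>2 * met_N q)"

definition hess_mix :: "real \<Rightarrow> real" where
  "hess_mix q = 4 * (4 * (q - 2) / (1 + q) ^ 4) - 2 * dens_deriv q * (2 * chr_A q + chr_C q * q)"

text \<open>The numerator of 1 - Bq contains the factors N and 1 - q; together with the factor 1 - q
  of \<open>dens_deriv\<close> they give the square in \<open>hess_tan\<close>.\<close>

lemma hess_tan_eq:
  assumes q: "0 \<le> q"
  shows "2 * dens_deriv q * (1 - chr_B q * q) = met_a q * hess_tan q"
proof -
  define w N where w: "w = 1 + q" and N: "N = met_N q"
  note ctx = q w N
  let ?B = "2 * q ^ 4 + 12 * q ^ 3 + 19 * q\<^sup>2 + q - 2"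
  have "w ^ 5 - ?B * q = N * (1 - q) * (w\<^sup>2 + 3 * q)" unfolding w N met_N_def by algebra
  moreover have "1 - chr_B q * q = (w ^ 5 - ?B * q) / w ^ 5"
    unfolding chr_B_eq[OF ctx] using met_pos[OF ctx] by (simp add: divide_simps)
  ultimately have "1 - chr_B q * q = N * (1 - q) * (w\<^sup>2 + 3 * q) / w ^ 5" by (simp only:)
  then show ?thesis
    unfolding dens_deriv_def hess_tan_def met_a_eq[OF ctx] w[symmetric] N[symmetric]
    using met_pos[OF ctx] by (simp add: divide_simps) algebra
qed

lemma hess_coord_met:
  fixes x :: "real ^ 'n::finite"
  shows "hess_coord (radial_form met_a met_b) (\<lambda>y. dens (y \<bullet> y)) x v v
    = met_a (x \<bullet> x) * hess_tan (x \<bullet> x) * (v \<bullet> v) + hess_mix (x \<bullet> x) * (x \<bullet> v)\<^sup>2"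
  unfolding hess_coord_radial[OF christoffel_met DERIV_dens[OF inner_ge_zero] DERIV_dens_deriv[OF inner_ge_zero]]
    hess_tan_eq[OF inner_ge_zero] hess_mix_def
  by (simp add: power2_eq_square algebra_simps)

section \<open>Radial eigenvalues and positivity of the three sums\<close>

definition curv_rad :: "real \<Rightarrow> real" where
  "curv_rad q = (36 * q - 2 * (1 + q)\<^sup>2) / (4 * met_N q)"

definition hess_rad :: "real \<Rightarrow> real" where
  "hess_rad q = ((1 + q)\<^sup>2 - 8 * q) / (1 + q)\<^sup>2"

lemma curv_mix_eq:
  assumes q: "0 \<le> q"
  shows "q * curv_mix q = 4 / (1 + q)\<^sup>2 * curv_rad q - met_a q * curv_tan q"
proof -
  define w N where w: "w = 1 + q" and N: "N = met_N q"
  note ctx = q w N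
  let ?P = "- 2 * w ^ 4 + 15 * q * w\<^sup>2 + 36 * q\<^sup>2"
  have "q * (23 * w ^ 4 - 51 * q * w\<^sup>2 - 36 * q\<^sup>2) = w ^ 4 * (36 * q - 2 * w\<^sup>2) - ?P * N"
    unfolding w N met_N_def by algebra
  moreover have "4 / w\<^sup>2 * curv_rad q - met_a q * curv_tan q
    = (w ^ 4 * (36 * q - 2 * w\<^sup>2) - ?P * N) / (w ^ 6 * N)"
    unfolding met_a_eq[OF ctx] curv_tan_def curv_rad_def w[symmetric] N[symmetric]
    using met_pos[OF ctx] by (simp add: divide_simps) algebra
  ultimately show ?thesis by (simp add: curv_mix_def w N)
qed

lemma hess_mix_eq:
  assumes q: "0 \<le> q"
  shows "q * hess_mix q = 4 / (1 + q)\<^sup>2 * hess_rad q - met_a q * hess_tan q"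
proof -
  define w N where w: "w = 1 + q" and N: "N = met_N q"
  note ctx = q w N
  let ?A = "- 2 * q * (q + 4)" and ?C = "(1 - q) * (7 * q\<^sup>2 + 17 * q + 7)"
  have "q * (16 * (q - 2) * w ^ 4 * N - 4 * (1 - q) * (2 * ?A * w ^ 4 + ?C * q))
    = N * (4 * (w\<^sup>2 - 8 * q) * w ^ 4 - 4 * N * (1 - q)\<^sup>2 * (w\<^sup>2 + 3 * q))"
    unfolding w N met_N_def by algebra
  moreover have "hess_mix q
    = (16 * (q - 2) * w ^ 4 * N - 4 * (1 - q) * (2 * ?A * w ^ 4 + ?C * q)) / (w ^ 8 * N)"
    unfolding hess_mix_def dens_deriv_def chr_A_eq[OF ctx] chr_C_eq[OF ctx] w[symmetric]
    using met_pos[OF ctx] by (simp add: divide_simps) algebra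
  moreover have "4 / w\<^sup>2 * hess_rad q - met_a q * hess_tan q
    = N * (4 * (w\<^sup>2 - 8 * q) * w ^ 4 - 4 * N * (1 - q)\<^sup>2 * (w\<^sup>2 + 3 * q)) / (w ^ 8 * N)"
    unfolding met_a_eq[OF ctx] hess_tan_def hess_rad_def w[symmetric] N[symmetric]
    using met_pos[OF ctx] by (simp add: divide_simps) algebra
  ultimately show ?thesis unfolding w[symmetric] by simp
qed

text \<open>With y = w^2 one has y - 4q = (1 - q)^2 \<ge> 0, that is, t \<le> 1. Each sum is a
  fraction whose numerator has positive coefficients in y, q and y - 4q.\<close>

lemma weighted_radial_pos:
  assumes q: "0 \<le> q"
  shows "0 < curv_rad q + hess_rad q" "0 < curv_rad q + hess_tan q" "0 < curv_tan q + hess_tan q"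
proof -
  define w N where w: "w = 1 + q" and N: "N = met_N q"
  note ctx = q w N
  note pos = met_pos[OF ctx]
  define y where "y = w\<^sup>2"
  have y: "0 < y" using pos by (simp add: y_def)
  have yq: "y - 4 * q = (1 - q)\<^sup>2" unfolding y_def w by algebra
  then have y4: "4 * q \<le> y" using zero_le_power2[of "1 - q"] by linarith
  have N': "N = y + q" by (simp add: y_def met_N_eq[OF ctx])
  have w4: "w ^ 4 = y\<^sup>2" by (simp add: y_def flip: power_mult)
  have "0 < (2 * y\<^sup>2 + 8 * q * (y - 4 * q)) / (4 * y * N)"
    using y y4 q pos by (intro divide_pos_pos add_pos_nonneg) auto
  also have "\<dots> = curv_rad q + hess_rad q"
    unfolding curv_rad_def hess_rad_def w[symmetric] N[symmetric] y_def[symmetric]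
    using y pos unfolding N' by (simp add: divide_simps) algebra
  finally show "0 < curv_rad q + hess_rad q" .
  have "0 < (2 * y\<^sup>2 + (20 * q * y + 12 * q * (y - 4 * q))) / (4 * y * N)"
    using y y4 q pos by (intro divide_pos_pos add_pos_nonneg add_nonneg_nonneg) auto
  also have "\<dots> = curv_rad q + hess_tan q"
    unfolding curv_rad_def hess_tan_def w[symmetric] N[symmetric] y_def[symmetric] yq[symmetric]
    using y pos unfolding N' by (simp add: divide_simps) algebra
  finally show "0 < curv_rad q + hess_tan q" .
  have "0 < (2 * y ^ 3 + (15 * q * y * (y - 4 * q) + (32 * q\<^sup>2 * y + 12 * q\<^sup>2 * (y - 4 * q)))) / (4 * y * N\<^sup>2)"
    using y y4 q pos by (intro divide_pos_pos add_pos_nonneg add_nonneg_nonneg) auto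
  also have "\<dots> = curv_tan q + hess_tan q"
    unfolding curv_tan_def hess_tan_def w[symmetric] N[symmetric] w4 y_def[symmetric] yq[symmetric]
    using y pos unfolding N' by (simp add: divide_simps) algebra
  finally show "0 < curv_tan q + hess_tan q" .
qed

lemma weighted_curvature_coord_pos:
  fixes x u v :: "real ^ 'n::finite"
  assumes on: "inner_coord (radial_form met_a met_b x) u u = 1"
    "inner_coord (radial_form met_a met_b x) v v = 1"
    "inner_coord (radial_form met_a met_b x) u v = 0"
  shows "0 < inner_coord (radial_form met_a met_b x) (curvature_vec (radial_form met_a met_b) x u v v) u
    + hess_coord (radial_form met_a met_b) (\<lambda>y. dens (y \<bullet> y)) x v v"
proof (cases "x = 0")
  case True
  \<comment> \<open>At a pole there is no radial direction and no division by q. The metric is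
    \<open>met_a 0\<close> times the Euclidean one, and only the tangential values remain.\<close>
  have "0 < curv_tan 0 + hess_tan 0" by (rule weighted_radial_pos) simp
  moreover have "met_a 0 * (u \<bullet> u) = 1" "met_a 0 * (v \<bullet> v) = 1" "met_a 0 * (u \<bullet> v) = 0"
    using on by (simp_all add: inner_coord_radial_form True)
  then have "met_a 0 * (met_a 0 * curv_tan 0) * ((u \<bullet> u) * (v \<bullet> v) - (u \<bullet> v)\<^sup>2) + met_a 0 * hess_tan 0 * (v \<bullet> v)
    = curv_tan 0 + hess_tan 0"
    by algebra
  ultimately show ?thesis unfolding inner_coord_curvature_met hess_coord_met True by simp
next
  case False
  define q where "q = x \<bullet> x"
  have q: "0 < q" using False by (simp add: q_def)
  then have q0: "0 \<le> q" by simp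
  note pos = met_pos[OF q0 refl refl]
  have "0 < met_a q * (met_a q * curv_tan q) * ((u \<bullet> u) * (v \<bullet> v) - (u \<bullet> v)\<^sup>2)
      + met_a q * curv_mix q * ((x \<bullet> u)\<^sup>2 * (v \<bullet> v) + (x \<bullet> v)\<^sup>2 * (u \<bullet> u) - 2 * (x \<bullet> u) * (x \<bullet> v) * (u \<bullet> v))
      + met_a q * hess_tan q * (v \<bullet> v) + hess_mix q * (x \<bullet> v)\<^sup>2"
  proof (rule weighted_curvature_combination_pos[where q = q and b = "met_b q" and c = "4 / (1 + q)\<^sup>2"
        and kr = "curv_rad q" and fr = "hess_rad q"])
    show "0 < 4 / (1 + q)\<^sup>2" using pos by simp
    show "0 < met_a q" using pos by (simp add: met_a_eq[OF q0 refl refl])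
    show "met_b q * q = 4 / (1 + q)\<^sup>2 - met_a q" using met_c_eq[OF q0 refl refl] by simp
    show "(x \<bullet> u)\<^sup>2 * (v \<bullet> v) + (x \<bullet> v)\<^sup>2 * (u \<bullet> u) - 2 * (x \<bullet> u) * (x \<bullet> v) * (u \<bullet> v)
      \<le> q * ((u \<bullet> u) * (v \<bullet> v) - (u \<bullet> v)\<^sup>2)" unfolding q_def by (rule gram_determinant)
  qed (use on q weighted_radial_pos[OF q0] curv_mix_eq[OF q0] hess_mix_eq[OF q0] in
      \<open>simp_all add: inner_coord_radial_form q_def[symmetric] power2_eq_square mult.assoc\<close>)
  then show ?thesis
    unfolding inner_coord_curvature_met hess_coord_met q_def by (simp add: algebra_simps)
qed

section \<open>The metric on the sphere\<close>

lemma one_plus_inner_self_pos: "0 < 1 + x \<bullet> (x :: 'a::real_inner)"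
  by (intro add_pos_nonneg) auto

text \<open>Both components are expressed by the single radial function 2/(1 + q), so only this
  function has to be differentiated.\<close>

lemma stereo_inv_inner:
  "stereo_inv s x = ((2 / (1 + x \<bullet> x)) *\<^sub>R x, s * (2 / (1 + x \<bullet> x) - 1))"
  using one_plus_inner_self_pos[of x]
  by (simp add: stereo_inv_def power2_norm_eq_inner divide_simps)

lemma has_derivative_stereo_inv:
  fixes x :: "real ^ 'n::finite"
  shows "(stereo_inv s has_derivative
    (\<lambda>v. ((2 / (1 + x \<bullet> x)) *\<^sub>R v - (4 * (x \<bullet> v) / (1 + x \<bullet> x)\<^sup>2) *\<^sub>R x,
      - s * (4 * (x \<bullet> v) / (1 + x \<bullet> x)\<^sup>2)))) (at x)"
proof -
  have "((\<lambda>q. 2 / (1 + q)) has_real_derivative - 2 / (1 + x \<bullet> x)\<^sup>2) (at (x \<bullet> x))"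
    using DERIV_divide_power[of "\<lambda>_. 2" 0 "x \<bullet> x" 1] one_plus_inner_self_pos[of x]
    by (simp add: eval_nat_numeral)
  from has_derivative_radial[OF this]
  have r: "((\<lambda>y. 2 / (1 + y \<bullet> y)) has_derivative (\<lambda>v. - (4 * (x \<bullet> v) / (1 + x \<bullet> x)\<^sup>2))) (at x)"
    by simp
  show ?thesis
    unfolding stereo_inv_inner[abs_def]
    by (rule has_derivative_eq_rhs, (rule derivative_intros r)+) (auto simp: fun_eq_iff)
qed

text \<open>The left side is t = \<open>sin r ^ 2\<close>. The height enters squared, so both charts
  give the same function of q.\<close>

lemma snd_stereo_inv_square:
  assumes "s \<in> {1, -1}"
  shows "1 - (snd (stereo_inv s x))\<^sup>2 = 4 * (x \<bullet> x) / (1 + x \<bullet> x)\<^sup>2"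
proof -
  have "(snd (stereo_inv s x))\<^sup>2 = (2 / (1 + x \<bullet> x) - 1)\<^sup>2"
    using assms by (auto simp: stereo_inv_inner power2_eq_square)
  then show ?thesis
    using one_plus_inner_self_pos[of x] by (simp add: divide_simps) algebra
qed

text \<open>With t = 1 - z^2 and h = 1 + t/4 one has h^2 - 1 = t (1/2 + t/16), while dz^2 = t dr^2.
  Subtracting the second term from h^2 times the round metric thus resets the coefficient of dr^2 to
  1 and leaves h^2 t on the unit sphere factor.\<close>

definition rot_metric :: "('n::finite) metric" where
  "rot_metric p u v = (1 + (1 - (snd p)\<^sup>2) / 4)\<^sup>2 * (u \<bullet> v)
     - (1 / 2 + (1 - (snd p)\<^sup>2) / 16) * (snd u * snd v)"

definition rot_density :: "('n::finite) ambient \<Rightarrow> real" where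
  "rot_density p = (1 - (snd p)\<^sup>2) / 2"

lemma rot_density_stereo_inv:
  "s \<in> {1, -1} \<Longrightarrow> (\<lambda>x. rot_density (stereo_inv s x)) = (\<lambda>x. dens (x \<bullet> x))"
  by (simp add: rot_density_def snd_stereo_inv_square dens_def del: insert_iff)

lemma rot_coefficients:
  assumes q: "0 \<le> q" and t: "t = 4 * q / (1 + q)\<^sup>2"
  shows "(1 + t / 4)\<^sup>2 * 4 / (1 + q)\<^sup>2 = met_a q"
    "(1 / 2 + t / 16) * 16 / (1 + q) ^ 4 = - met_b q"
proof -
  define w N where w: "w = 1 + q" and N: "N = met_N q"
  note ctx = q w N
  have "1 + t / 4 = N / w\<^sup>2"
    unfolding t met_N_eq[OF ctx] w[symmetric] using met_pos[OF ctx] by (simp add: divide_simps)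
  then show "(1 + t / 4)\<^sup>2 * 4 / (1 + q)\<^sup>2 = met_a q"
    unfolding met_a_eq[OF ctx] w[symmetric] using met_pos[OF ctx] by (simp add: divide_simps) algebra
  show "(1 / 2 + t / 16) * 16 / (1 + q) ^ 4 = - met_b q"
    unfolding t met_b_eq[OF ctx] w[symmetric] using met_pos[OF ctx] by (simp add: divide_simps) algebra
qed

text \<open>The sign s occurs only as s * s = 1. The ambient inner product becomes 4/w^2 times the
  identity, as stereographic projection is conformal, and dz^2 gives the rank-one part.\<close>

lemma metric_matrix_rot_metric:
  assumes s: "s \<in> {1, -1}"
  shows "metric_matrix rot_metric s = (radial_form met_a met_b :: real ^ 'n::finite \<Rightarrow> _)"
proof
  fix x :: "real ^ 'n"
  define w where "w = 1 + x \<bullet> x"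
  have w: "0 < w" unfolding w_def by (rule one_plus_inner_self_pos)
  define t where "t = 4 * (x \<bullet> x) / w\<^sup>2"
  have t: "1 - (snd (stereo_inv s x))\<^sup>2 = t" using snd_stereo_inv_square[OF s] by (simp add: t_def w_def)
  note D = frechet_derivative_at[OF has_derivative_stereo_inv, symmetric]
  have ss: "s * s = 1" using s by auto
  have "metric_matrix rot_metric s x $ i $ j = radial_form met_a met_b x $ i $ j" for i j
  proof -
    let ?e = "\<lambda>i. axis i 1 :: real ^ 'n"
    let ?d = "\<lambda>i. frechet_derivative (stereo_inv s) (at x) (axis i 1)"
    have q: "x \<bullet> x = w - 1" by (simp add: w_def)
    have z: "snd (?d i) * snd (?d j) = 16 * (x $ i * x $ j) / w ^ 4"
      unfolding D using ss by (simp add: inner_axis w_def[symmetric] power2_eq_square power4_eq_xxxx)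
        (metis (no_types, opaque_lifting) mult.assoc mult.left_commute mult_1)
    have "?d i \<bullet> ?d j = 4 / w\<^sup>2 * kdelta i j - 16 / w ^ 3 * (x $ i * x $ j)
        + 16 / w ^ 4 * (x $ i * x $ j) * (x \<bullet> x) + snd (?d i) * snd (?d j)"
      unfolding D by (simp add: inner_Pair inner_simps inner_axis inner_axis' axis_nth_kdelta w_def[symmetric])
        (use w in \<open>simp add: divide_simps\<close>, algebra)
    also have "\<dots> = 4 / w\<^sup>2 * kdelta i j"
      unfolding z q using w by (simp add: divide_simps) algebra
    finally have dd: "?d i \<bullet> ?d j = 4 / w\<^sup>2 * kdelta i j" .
    have "metric_matrix rot_metric s x $ i $ j
      = (1 + t / 4)\<^sup>2 * (?d i \<bullet> ?d j) - (1 / 2 + t / 16) * (snd (?d i) * snd (?d j))"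
      by (simp add: metric_matrix_def rot_metric_def t)
    also have "\<dots> = ((1 + t / 4)\<^sup>2 * 4 / w\<^sup>2) * kdelta i j - ((1 / 2 + t / 16) * 16 / w ^ 4) * (x $ i * x $ j)"
      unfolding dd z by (simp only: times_divide_eq_left times_divide_eq_right mult.assoc)
    finally show ?thesis
      unfolding w_def rot_coefficients[OF inner_ge_zero t_def[unfolded w_def]]
      by (simp add: radial_form_def)
  qed
  then show "metric_matrix rot_metric s x = radial_form met_a met_b x" by (simp add: vec_eq_iff)
qed

lemma smooth_on_sphere_rot_density: "smooth_on_sphere (rot_density :: 'n::finite ambient \<Rightarrow> real)"
proof -
  have "1 + x \<bullet> x \<noteq> 0" for x :: "real ^ 'n" using one_plus_inner_self_pos[of x] by simp
  then have "smooth (\<lambda>x :: real ^ 'n. dens (x \<bullet> x))"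
    unfolding dens_def by (intro smooth_intros) auto
  then show ?thesis
    by (simp add: smooth_on_sphere_def rot_density_stereo_inv del: insert_iff ball_simps)
qed

lemma smooth_radial_form_met: "smooth (\<lambda>x :: real ^ 'n::finite. radial_form met_a met_b x $ i $ j)"
proof -
  have "1 + x \<bullet> x \<noteq> 0" for x :: "real ^ 'n" using one_plus_inner_self_pos[of x] by simp
  then show ?thesis
    unfolding radial_form_def met_a_def met_b_def met_N_def vec_lambda_beta
    by (intro smooth_intros) auto
qed

lemma riemannian_metric_rot_metric: "riemannian_metric (rot_metric :: 'n::finite metric)"
  unfolding riemannian_metric_def
proof (intro conjI ballI allI impI)
  fix s :: real and i j :: 'n assume "s \<in> {1, -1}"
  then show "smooth (\<lambda>x. metric_matrix rot_metric s x $ i $ j)"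
    by (simp only: metric_matrix_rot_metric smooth_radial_form_met)
next
  fix p u v w :: "'n ambient"
  assume p: "p \<in> unit_sphere" and u: "u \<in> tangent_space p"
  show "rot_metric p u v = rot_metric p v u" by (simp add: rot_metric_def inner_commute mult.commute)
  show "rot_metric p (a *\<^sub>R u + b *\<^sub>R v) w = a * rot_metric p u w + b * rot_metric p v w" for a b
  proof -
    define h k where "h = (1 + (1 - (snd p)\<^sup>2) / 4)\<^sup>2" and "k = 1 / 2 + (1 - (snd p)\<^sup>2) / 16"
    show ?thesis unfolding rot_metric_def h_def[symmetric] k_def[symmetric]
      by (simp add: inner_simps algebra_simps)
  qed
  assume u0: "u \<noteq> 0"
  obtain y z where p_eq: "p = (y, z)" by fastforce
  obtain U c where u_eq: "u = (U, c)" by fastforce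
  have yz: "y \<bullet> y + z * z = 1" using p by (simp add: p_eq norm_eq_1 inner_Pair)
  have "y \<bullet> U = - z * c" using u by (simp add: p_eq u_eq tangent_space_def inner_Pair)
  moreover have yy: "y \<bullet> y = 1 - z\<^sup>2" using yz by (simp add: power2_eq_square)
  \<comment> \<open>Tangency expresses the product of y and U by z c, so Cauchy-Schwarz bounds the
    vertical component c of u.\<close>
  ultimately have "(z * c)\<^sup>2 \<le> (1 - z\<^sup>2) * (U \<bullet> U)"
    using Cauchy_Schwarz_ineq[of y U] by simp
  then have c: "c\<^sup>2 \<le> (1 - z\<^sup>2) * (u \<bullet> u)"
    by (simp add: u_eq inner_Pair power2_eq_square algebra_simps)
  have z: "0 \<le> 1 - z\<^sup>2" using inner_ge_zero[of y] unfolding yy .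
  have "0 < u \<bullet> u" using u0 by simp
  \<comment> \<open>The coefficients satisfy (1 + t/4)^2 - t (1/2 + t/16) = 1; with the bound on c
    the metric therefore dominates the round one.\<close>
  also have "u \<bullet> u = (1 + (1 - z\<^sup>2) / 4)\<^sup>2 * (u \<bullet> u) - (1 / 2 + (1 - z\<^sup>2) / 16) * ((1 - z\<^sup>2) * (u \<bullet> u))"
  proof -
    have "r = (1 + t / 4)\<^sup>2 * r - (1 / 2 + t / 16) * (t * r)" for r t :: real
      by (simp add: power2_eq_square field_simps)
    then show ?thesis .
  qed
  also have "\<dots> \<le> rot_metric p u u"
    unfolding rot_metric_def using z mult_left_mono[OF c, of "1 / 2 + (1 - z\<^sup>2) / 16"]
    by (simp add: p_eq u_eq power2_eq_square)
  finally show "0 < rot_metric p u u" .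
qed

section \<open>Polar coordinates and the warping profile\<close>

lemma has_derivative_polar_map:
  "(polar_map (pi / 2) has_derivative
    (\<lambda>(a, \<xi>). (sin r *\<^sub>R \<xi> + (a * cos r) *\<^sub>R \<theta>, - (a * sin r)))) (at (r, \<theta> :: real ^ 'n::finite))"
proof -
  have "polar_map (pi / 2) = (\<lambda>x. (sin (fst x) *\<^sub>R (snd x :: real ^ 'n), cos (fst x)))"
    by (auto simp: polar_map_def fun_eq_iff)
  moreover have "((\<lambda>x. (sin (fst x) *\<^sub>R (snd x :: real ^ 'n), cos (fst x))) has_derivative
    (\<lambda>(a, \<xi>). (sin r *\<^sub>R \<xi> + (a * cos r) *\<^sub>R \<theta>, - (a * sin r)))) (at (r, \<theta>))"
    by (rule has_derivative_eq_rhs, (rule derivative_intros)+) (auto simp: fun_eq_iff)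
  ultimately show ?thesis by simp
qed

text \<open>The constants come from sin^3 r = (3 sin r - sin (3r))/4.\<close>

definition profile :: "real \<Rightarrow> real" where
  "profile r = 19 / 16 * sin r + (- 1 / 16) * sin (3 * r)"

text \<open>Written with \<open>sin (3r)\<close>, the profile has even derivatives that are visibly combinations of sines.\<close>

lemma profile_eq: "profile r = sin r * (1 + (sin r)\<^sup>2 / 4)"
proof -
  have "sin (3 * r) = 3 * sin r - 4 * sin r ^ 3"
  proof -
    have "sin (3 * r) = sin (2 * r + r)" by simp
    also have "\<dots> = 2 * sin r * (cos r)\<^sup>2 + (2 * (cos r)\<^sup>2 - 1) * sin r"
      by (simp only: sin_add sin_double cos_double_cos power2_eq_square)
    also have "\<dots> = 3 * sin r - 4 * sin r ^ 3"
      unfolding cos_squared_eq by algebra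
    finally show ?thesis .
  qed
  then show ?thesis unfolding profile_def by (simp add: field_simps eval_nat_numeral)
qed

lemma deriv_sin_combination: "deriv (\<lambda>r. a * sin r + b * sin (3 * r)) = (\<lambda>r. a * cos r + 3 * b * cos (3 * r))"
  for a b :: real
  by (rule ext, rule DERIV_imp_deriv) (auto intro!: derivative_eq_intros)

lemma deriv_cos_combination:
  "deriv (\<lambda>r. a * cos r + b * cos (3 * r)) = (\<lambda>r. - a * sin r + - 3 * b * sin (3 * r))"
  for a b :: real
  by (rule ext, rule DERIV_imp_deriv) (auto intro!: derivative_eq_intros)

text \<open>Two derivatives preserve the span of sin r and sin (3r). Every element of it vanishes at
  0 and pi, so the coefficients can stay existential.\<close>

lemma even_deriv_sin_combination:
  fixes a b :: real
  shows "\<exists>a' b'. (deriv ^^ (2 * k)) (\<lambda>r. a * sin r + b * sin (3 * r)) = (\<lambda>r. a' * sin r + b' * sin (3 * r))"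
proof (induction k)
  case (Suc k)
  then obtain a' b' where
    "(deriv ^^ (2 * k)) (\<lambda>r. a * sin r + b * sin (3 * r)) = (\<lambda>r. a' * sin r + b' * sin (3 * r))" by blast
  then have "(deriv ^^ (2 * Suc k)) (\<lambda>r. a * sin r + b * sin (3 * r))
    = (\<lambda>r. - a' * sin r + - 3 * (3 * b') * sin (3 * r))"
    by (simp only: mult_Suc_right add_2_eq_Suc funpow.simps o_apply deriv_sin_combination deriv_cos_combination)
  then show ?case by blast
qed auto

lemma warping_profile_profile: "warping_profile (pi / 2) profile"
proof -
  have prof: "profile = (\<lambda>r. 19 / 16 * sin r + (- 1 / 16) * sin (3 * r))"
    by (auto simp: profile_def)
  have s3: "sin (3 * pi) = 0" "cos (3 * pi) = -1"
    using sin_npi[of 3] cos_npi[of 3] by (simp_all add: mult.commute)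
  have "(deriv ^^ k) profile 0 = 0 \<and> (deriv ^^ k) profile pi = 0" if ev: "even k" for k
  proof -
    obtain m where m: "k = 2 * m" using ev by (rule evenE)
    then show ?thesis
      using even_deriv_sin_combination[of m "19 / 16" "- 1 / 16"] s3 unfolding prof by auto
  qed
  moreover have "smooth profile"
    unfolding prof using smooth_sin[of 1] by (intro smooth_intros) simp
  moreover have "0 < profile r" if "0 < r" "r < pi" for r
    unfolding profile_eq using sin_gt_zero[OF that] by (intro mult_pos_pos add_pos_nonneg) auto
  moreover have "deriv profile 0 = 1" "deriv profile pi = -1"
    unfolding prof deriv_sin_combination using s3 by simp_all
  moreover have "profile 0 = 0" "profile pi = 0" by (simp_all add: profile_eq)
  ultimately show ?thesis by (simp add: warping_profile_def)
qed

lemma rotationally_symmetric_rot_metric: "rotationally_symmetric (rot_metric :: 'n::finite metric)"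
  unfolding rotationally_symmetric_def
proof (intro conjI exI[of _ "pi / 2"] exI[of _ profile] ballI allI impI)
  fix r a b :: real and \<theta> \<xi> \<eta> :: "real ^ 'n"
  assume "\<theta> \<in> sphere 0 1" and o: "\<theta> \<bullet> \<xi> = 0" "\<theta> \<bullet> \<eta> = 0"
  then have \<theta>: "\<theta> \<bullet> \<theta> = 1" by (simp add: norm_eq_1)
  note D = frechet_derivative_at[OF has_derivative_polar_map, symmetric]
  have "snd (polar_map (pi / 2) (r, \<theta>)) = cos r" by (simp add: polar_map_def)
  then have t: "1 - (snd (polar_map (pi / 2) (r, \<theta>)))\<^sup>2 = (sin r)\<^sup>2" by (simp add: sin_squared_eq)
  have "(sin r *\<^sub>R \<xi> + (a * cos r) *\<^sub>R \<theta>, - (a * sin r)) \<bullet> (sin r *\<^sub>R \<eta> + (b * cos r) *\<^sub>R \<theta>, - (b * sin r))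
    = (sin r)\<^sup>2 * (\<xi> \<bullet> \<eta>) + a * b * ((sin r)\<^sup>2 + (cos r)\<^sup>2)"
    using o \<theta>
    by (simp add: inner_Pair inner_simps inner_commute[of \<xi> \<theta>] power2_eq_square algebra_simps
        del: sin_cos_squared_add sin_cos_squared_add3)
  then have i: "(sin r *\<^sub>R \<xi> + (a * cos r) *\<^sub>R \<theta>, - (a * sin r)) \<bullet> (sin r *\<^sub>R \<eta> + (b * cos r) *\<^sub>R \<theta>, - (b * sin r))
    = (sin r)\<^sup>2 * (\<xi> \<bullet> \<eta>) + a * b"
    by simp
  \<comment> \<open>S stands for sin r and X for the product of \<xi> and \<eta>. The subtracted
    term reduces the factor of a * b from (1 + S^2/4)^2 to 1.\<close>
  have "(1 + S\<^sup>2 / 4)\<^sup>2 * (S\<^sup>2 * X + a * b) - (1 / 2 + S\<^sup>2 / 16) * (- (a * S) * - (b * S))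
    = a * b + (S * (1 + S\<^sup>2 / 4))\<^sup>2 * X" for S X
    by (simp add: power2_eq_square field_simps)
  then show "rot_metric (polar_map (pi / 2) (r, \<theta>))
             (frechet_derivative (polar_map (pi / 2)) (at (r, \<theta>)) (a, \<xi>))
             (frechet_derivative (polar_map (pi / 2)) (at (r, \<theta>)) (b, \<eta>))
           = a * b + (profile r)\<^sup>2 * (\<xi> \<bullet> \<eta>)"
    unfolding rot_metric_def D profile_eq t case_prod_conv i snd_conv .
qed (simp_all add: riemannian_metric_rot_metric warping_profile_profile)

section \<open>Tangent vectors and orthonormal pairs in the chart\<close>

lemma has_derivative_stereo:
  fixes p :: "'n::finite ambient"
  assumes "1 + s * snd p \<noteq> 0"
  shows "(stereo s has_derivative
    (\<lambda>U. (1 / (1 + s * snd p)) *\<^sub>R fst U - (s * snd U / (1 + s * snd p)\<^sup>2) *\<^sub>R fst p)) (at p)"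
proof -
  have "((\<lambda>p :: 'n ambient. inverse (1 + s * snd p)) has_derivative
      (\<lambda>U. - (s * snd U / (1 + s * snd p)\<^sup>2))) (at p)"
    by (rule has_derivative_eq_rhs, (rule derivative_intros assms)+)
      (simp add: fun_eq_iff power2_eq_square divide_inverse mult.assoc mult.left_commute)
  from has_derivative_scaleR[OF this has_derivative_fst[OF has_derivative_ident]]
  show ?thesis
    unfolding stereo_def[abs_def]
    by (rule has_derivative_eq_rhs) (simp add: fun_eq_iff inverse_eq_divide)
qed

text \<open>\<open>coord_vec\<close> differentiates \<open>stereo\<close>, whereas
  \<open>metric_matrix\<close> differentiates \<open>stereo_inv\<close>. The two are matched by
  computing all products in terms of e = 1 + s z, which \<open>chart_at\<close> keeps
  positive.\<close>

lemma inner_coord_coord_vec: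
  fixes p U V :: "'n::finite ambient"
  assumes p: "p \<in> unit_sphere" and U: "U \<in> tangent_space p" and V: "V \<in> tangent_space p"
    and x: "x = stereo (chart_at p) p"
  shows "inner_coord (radial_form met_a met_b x) (coord_vec p U) (coord_vec p V) = rot_metric p U V"
proof -
  define s where "s = chart_at p"
  have s: "s \<in> {1, -1}" "0 \<le> s * snd p" by (auto simp: s_def chart_at_def)
  obtain y z where p_eq: "p = (y, z)" by fastforce
  obtain U' c where U_eq: "U = (U', c)" by fastforce
  obtain V' d where V_eq: "V = (V', d)" by fastforce
  define e where "e = 1 + s * z"
  have e: "0 < e" using s by (simp add: e_def p_eq)
  have ss: "s * s = 1" using s by auto
  have y: "y \<bullet> y = e * (2 - e)"
  proof -
    have "y \<bullet> y = 1 - z * z" using p by (simp add: p_eq norm_eq_1 inner_Pair eq_diff_eq)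
    also have "\<dots> = e * (2 - e)" unfolding e_def using ss by algebra
    finally show ?thesis .
  qed
  have yU: "y \<bullet> U' = - (s * (e - 1) * c)" "y \<bullet> V' = - (s * (e - 1) * d)"
  proof -
    have "z = s * (e - 1)" using ss unfolding e_def by algebra
    moreover have "y \<bullet> U' = - (z * c)" "y \<bullet> V' = - (z * d)"
      using U V by (simp_all add: p_eq U_eq V_eq tangent_space_def inner_Pair)
    ultimately show "y \<bullet> U' = - (s * (e - 1) * c)" "y \<bullet> V' = - (s * (e - 1) * d)"
      by simp_all
  qed
  have x_eq: "x = (1 / e) *\<^sub>R y" by (simp add: x stereo_def p_eq e_def s_def[unfolded p_eq, symmetric] inverse_eq_divide)
  have cv: "coord_vec p W = (1 / e) *\<^sub>R fst W - (s * snd W / e\<^sup>2) *\<^sub>R y" for W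
  proof -
    have "1 + s * snd p \<noteq> 0" using e by (simp add: p_eq e_def)
    from frechet_derivative_at[OF has_derivative_stereo[OF this], symmetric]
    show ?thesis by (simp add: coord_vec_def s_def[unfolded p_eq, symmetric] p_eq e_def)
  qed
  have q: "x \<bullet> x = (2 - e) / e" using e by (simp add: x_eq y)
  have w: "1 + x \<bullet> x = 2 / e" using e by (simp add: q divide_simps)
  have xU: "x \<bullet> coord_vec p U = - (s * c / e\<^sup>2)" "x \<bullet> coord_vec p V = - (s * d / e\<^sup>2)"
  proof -
    have *: "x \<bullet> coord_vec p W = 1 / e * (1 / e * (y \<bullet> fst W) - s * snd W / e\<^sup>2 * (y \<bullet> y))" for W
      unfolding x_eq cv by (simp add: inner_simps algebra_simps)
    have "1 / e * (1 / e * (- (s * (e - 1) * c)) - s * c / e\<^sup>2 * (e * (2 - e))) = - (s * c / e\<^sup>2)" for c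
      using e by (simp add: field_simps power2_eq_square)
    then show "x \<bullet> coord_vec p U = - (s * c / e\<^sup>2)" "x \<bullet> coord_vec p V = - (s * d / e\<^sup>2)"
      unfolding * U_eq V_eq fst_conv snd_conv y yU by auto
  qed
  \<comment> \<open>Stereographic projection scales lengths of tangent vectors by 1/e; the mixed
    terms combine into the product c d of the vertical components.\<close>
  have UV: "coord_vec p U \<bullet> coord_vec p V = (U \<bullet> V) / e\<^sup>2"
  proof -
    have "coord_vec p U \<bullet> coord_vec p V = (U' \<bullet> V') / e\<^sup>2 - s * d / e ^ 3 * (y \<bullet> U')
        - s * c / e ^ 3 * (y \<bullet> V') + (s * c / e\<^sup>2) * (s * d / e\<^sup>2) * (y \<bullet> y)"
      unfolding cv U_eq V_eq using e
      by (simp add: inner_simps inner_commute[of U' y] power2_eq_square power3_eq_cube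
          diff_divide_distrib add_divide_distrib right_diff_distrib mult_ac)
    also have "\<dots> = (U' \<bullet> V' + (s * s) * (c * d)) / e\<^sup>2"
      unfolding y yU using e by (simp add: field_simps eval_nat_numeral)
    finally show ?thesis by (simp add: ss U_eq V_eq)
  qed
  define t where "t = 1 - (snd p)\<^sup>2"
  have t: "t = 4 * (x \<bullet> x) / (1 + x \<bullet> x)\<^sup>2"
  proof -
    have "t = e * (2 - e)" unfolding t_def e_def p_eq using ss by (simp, algebra)
    moreover have "4 * ((2 - e) / e) / (2 / e)\<^sup>2 = e * (2 - e)"
      using e by (simp add: power_divide) (simp add: power2_eq_square)
    ultimately show ?thesis unfolding w unfolding q by (simp only:)
  qed
  have "inner_coord (radial_form met_a met_b x) (coord_vec p U) (coord_vec p V)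
    = met_a (x \<bullet> x) * ((U \<bullet> V) / e\<^sup>2) + met_b (x \<bullet> x) * ((s * s) * (c * d) / e ^ 4)"
    unfolding inner_coord_radial_form UV xU by (simp add: power2_eq_square power4_eq_xxxx algebra_simps)
  also have "\<dots> = (1 + t / 4)\<^sup>2 * (U \<bullet> V) - (1 / 2 + t / 16) * (c * d)"
  proof -
    have "h * 4 / (2 / e)\<^sup>2 = h * e\<^sup>2" "h * 16 / (2 / e) ^ 4 = h * e ^ 4" for h
      by (simp_all add: power_divide)
    then have a: "met_a (x \<bullet> x) = (1 + t / 4)\<^sup>2 * e\<^sup>2"
      and b: "met_b (x \<bullet> x) = - ((1 / 2 + t / 16) * e ^ 4)"
      using rot_coefficients[OF inner_ge_zero t] unfolding w by (simp_all only: minus_equation_iff)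
    show ?thesis unfolding a b ss using e by simp
  qed
  finally show ?thesis by (simp add: rot_metric_def t_def U_eq V_eq)
qed

text \<open>An orthonormal pair stays orthonormal in coordinates, so the denominator of
  \<open>sec_coord\<close> is 1.\<close>

lemma
  fixes p U V :: "'n::finite ambient"
  assumes p: "p \<in> unit_sphere" and on: "orthonormal_pair rot_metric p U V"
    and x: "x = stereo (chart_at p) p"
  shows orthonormal_coord_vec:
      "inner_coord (radial_form met_a met_b x) (coord_vec p U) (coord_vec p U) = 1"
      "inner_coord (radial_form met_a met_b x) (coord_vec p V) (coord_vec p V) = 1"
      "inner_coord (radial_form met_a met_b x) (coord_vec p U) (coord_vec p V) = 0"
    and sec_rot_metric: "sec rot_metric p U V
      = inner_coord (radial_form met_a met_b x)
          (curvature_vec (radial_form met_a met_b) x (coord_vec p U) (coord_vec p V) (coord_vec p V)) (coord_vec p U)"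
proof -
  have s: "chart_at p \<in> {1, -1}" by (simp add: chart_at_def)
  show on': "inner_coord (radial_form met_a met_b x) (coord_vec p U) (coord_vec p U) = 1"
      "inner_coord (radial_form met_a met_b x) (coord_vec p V) (coord_vec p V) = 1"
      "inner_coord (radial_form met_a met_b x) (coord_vec p U) (coord_vec p V) = 0"
    using on by (simp_all add: orthonormal_pair_def inner_coord_coord_vec[OF p _ _ x])
  show "sec rot_metric p U V
      = inner_coord (radial_form met_a met_b x)
          (curvature_vec (radial_form met_a met_b) x (coord_vec p U) (coord_vec p V) (coord_vec p V)) (coord_vec p U)"
    unfolding sec_def sec_coord_def metric_matrix_rot_metric[OF s] x[symmetric] on' by simp
qed

lemma weighted_sec_pos_rot_metric:
  "weighted_sec_pos (rot_metric :: 'n::finite metric) rot_density"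
  unfolding weighted_sec_pos_def
proof (intro ballI allI impI)
  fix p U V :: "'n ambient"
  assume p: "p \<in> unit_sphere" and on: "orthonormal_pair rot_metric p U V"
  have s: "chart_at p \<in> {1, -1}" by (simp add: chart_at_def)
  show "0 < weighted_sec rot_metric rot_density p V U"
    unfolding weighted_sec_def sec_rot_metric[OF p on refl] Hess_def metric_matrix_rot_metric[OF s]
      rot_density_stereo_inv[OF s]
    by (intro weighted_curvature_coord_pos orthonormal_coord_vec[OF p on refl])
qed

text \<open>The witness is the plane of two different axes at the pole (0, 1), where q = 0 and the
  curvature is \<open>curv_tan 0\<close> = -1/2.\<close>

lemma not_sec_nonneg_rot_metric:
  assumes "2 \<le> CARD('n::finite)"
  shows "\<not> sec_nonneg (rot_metric :: 'n metric)"
proof -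
  obtain i j :: 'n where ij: "i \<noteq> j"
    using card_2_iff' [of "UNIV :: 'n set"] assms card_le_Suc0_iff_eq[of "UNIV :: 'n set"] by force
  define p U V :: "'n ambient" where "p = (0, 1)" and "U = (axis i 1, 0)" and "V = (axis j 1, 0)"
  have p: "p \<in> unit_sphere" by (simp add: p_def norm_Pair)
  have on: "orthonormal_pair rot_metric p U V"
    using ij by (simp add: orthonormal_pair_def tangent_space_def rot_metric_def p_def U_def V_def
        inner_Pair inner_axis_axis)
  have x: "0 = stereo (chart_at p) p" by (simp add: stereo_def p_def)
  have "met_a 0 * (coord_vec p U \<bullet> coord_vec p U) = 1" "met_a 0 * (coord_vec p V \<bullet> coord_vec p V) = 1"
    "met_a 0 * (coord_vec p U \<bullet> coord_vec p V) = 0"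
    using orthonormal_coord_vec[OF p on x] by (simp_all add: inner_coord_radial_form)
  then have "met_a 0 * (met_a 0 * curv_tan 0) * ((coord_vec p U \<bullet> coord_vec p U) * (coord_vec p V \<bullet> coord_vec p V)
    - (coord_vec p U \<bullet> coord_vec p V)\<^sup>2) = curv_tan 0"
    by algebra
  then have "sec rot_metric p U V = curv_tan 0"
    unfolding sec_rot_metric[OF p on x] inner_coord_curvature_met by simp
  then have "\<not> 0 \<le> sec rot_metric p U V" by (simp add: curv_tan_def met_N_def)
  then show ?thesis using p on unfolding sec_nonneg_def by blast
qed

theorem proposition2p11:
  assumes "2 \<le> CARD('n::finite)"
  shows "\<exists>(g :: 'n metric) f.
    rotationally_symmetric g \<and> smooth_on_sphere f \<and> weighted_sec_pos g f \<and> \<not> sec_nonneg g"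
  using rotationally_symmetric_rot_metric smooth_on_sphere_rot_density weighted_sec_pos_rot_metric
    not_sec_nonneg_rot_metric[OF assms] by blast

end
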